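(* Let $t \geq 2$ be an integer. Every $K^{\ast}_{2,t}$-minor-free graph $G$ is isomorphic to a subgraph of $H \boxtimes K_{t-1}$ for some graph $H$ with $\mathrm{tw}(H) \leq 2$.
   Context: All graphs are finite, simple and undirected. $\mathrm{tw}$ denotes treewidth. $K^{\ast}_{2,t}$ is the graph obtained from the complete bipartite graph $K_{2,t}$ by adding the edge between the two vertices of the part of size $2$. The strong product $A \boxtimes B$ has vertex-set $V(A)\times V(B)$, where distinct $(v,x),(w,y)$ are adjacent if ($v=w$ and $xy\in E(B)$), or ($x=y$ and $vw\in E(A)$), or ($vw\in E(A)$ and $xy\in E(B)$). $K_{t-1}$ is the complete graph on $t-1$ vertices. *)

theory Defs
  imports "Graph_Theory.Graph_Theory"
begin

text \<open>
  Finite simple undirected graphs are rendered as in the imported library: \<^locale>\<open>pair_graph\<close> is a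
  finite, loop-free, symmetric set of ordered pairs on a finite vertex set, so an undirected edge
  corresponds to the two arcs joining its ends.
\<close>

definition complete_graph :: "nat \<Rightarrow> nat pair_pre_digraph" where
  "complete_graph n = \<lparr> pverts = {..<n}, parcs = {(u, v). u < n \<and> v < n \<and> u \<noteq> v} \<rparr>"

text \<open>The parts of $K_{2,t}$ are \<open>{0, 1}\<close> and \<open>{2..<t + 2}\<close>.\<close>

definition K2_star :: "nat \<Rightarrow> nat pair_pre_digraph" where
  "K2_star t =
    \<lparr> pverts = {0, 1} \<union> {2..<t + 2},
      parcs = {0, 1} \<times> {2..<t + 2} \<union> {2..<t + 2} \<times> {0, 1} \<union> {(0, 1), (1, 0)} \<rparr>"

definition strong_product ::
  "'a pair_pre_digraph \<Rightarrow> 'b pair_pre_digraph \<Rightarrow> ('a \<times> 'b) pair_pre_digraph" where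
  "strong_product A B =
    \<lparr> pverts = pverts A \<times> pverts B,
      parcs = {((v, x), (w, y)).
        {(v, x), (w, y)} \<subseteq> pverts A \<times> pverts B \<and> (v, x) \<noteq> (w, y) \<and>
        (v = w \<and> (x, y) \<in> parcs B \<or>
         x = y \<and> (v, w) \<in> parcs A \<or>
         (v, w) \<in> parcs A \<and> (x, y) \<in> parcs B)} \<rparr>"

definition iso_to_subgraph :: "'a pair_pre_digraph \<Rightarrow> 'b pair_pre_digraph \<Rightarrow> bool" where
  "iso_to_subgraph G J \<longleftrightarrow>
    (\<exists>S. pair_graph S \<and> subgraph (with_proj S) (with_proj J) \<and>
         digraph_iso (with_proj G) (with_proj S))"

text \<open>
  The vertex arising from the contraction of \<open>uv\<close> keeps the name \<open>u\<close>; loops are discarded, and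
  parallel edges are identified because arcs are pairs.
\<close>

definition contract_edge :: "'a \<Rightarrow> 'a \<Rightarrow> 'a pair_pre_digraph \<Rightarrow> 'a pair_pre_digraph" where
  "contract_edge u v G = (let f = (\<lambda>x. if x = v then u else x) in
    \<lparr> pverts = f ` pverts G,
      parcs = {(f x, f y) | x y. (x, y) \<in> parcs G \<and> f x \<noteq> f y} \<rparr>)"

inductive contracts_to :: "'a pair_pre_digraph \<Rightarrow> 'a pair_pre_digraph \<Rightarrow> bool" for G where
  refl: "contracts_to G G"
| step: "contracts_to G M \<Longrightarrow> (u, v) \<in> parcs M \<Longrightarrow> contracts_to G (contract_edge u v M)"

definition is_minor :: "'b pair_pre_digraph \<Rightarrow> 'a pair_pre_digraph \<Rightarrow> bool" where
  "is_minor X G \<longleftrightarrow>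
    (\<exists>S M. pair_graph S \<and> subgraph (with_proj S) (with_proj G) \<and> contracts_to S M \<and>
           digraph_iso (with_proj X) (with_proj M))"

abbreviation minor_free :: "'b pair_pre_digraph \<Rightarrow> 'a pair_pre_digraph \<Rightarrow> bool" where
  "minor_free X G \<equiv> \<not> is_minor X G"

text \<open>
  The library predicate \<^const>\<open>tree\<close> is meant for directed graphs: in a symmetric digraph every edge
  yields a directed cycle of length 2. Undirected cycles are the cycles of length at least 3.
\<close>

definition undirected_tree :: "'a pair_pre_digraph \<Rightarrow> bool" where
  "undirected_tree T \<longleftrightarrow>
    pair_graph T \<and> Digraph_Component.connected (with_proj T) \<and>
    \<not> (\<exists>p. pre_digraph.cycle (with_proj T) p \<and> 3 \<le> length p)"

text \<open>The library notion of connectedness used here includes non-emptiness of the vertex set.\<close>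

definition tree_decomposition ::
  "'a pair_pre_digraph \<Rightarrow> 'i pair_pre_digraph \<Rightarrow> ('i \<Rightarrow> 'a set) \<Rightarrow> bool" where
  "tree_decomposition G T B \<longleftrightarrow>
    undirected_tree T \<and>
    (\<forall>i \<in> pverts T. B i \<subseteq> pverts G) \<and>
    (\<forall>(v, w) \<in> parcs G. \<exists>i \<in> pverts T. v \<in> B i \<and> w \<in> B i) \<and>
    (\<forall>v \<in> pverts G. Digraph_Component.connected (with_proj T \<restriction> {i \<in> pverts T. v \<in> B i}))"

definition decomposition_width :: "'i pair_pre_digraph \<Rightarrow> ('i \<Rightarrow> 'a set) \<Rightarrow> int" where
  "decomposition_width T B = Max ((\<lambda>i. int (card (B i))) ` pverts T) - 1"

text \<open>
  Every finite tree is isomorphic to one with natural numbers as vertices, so nothing is lost by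
  fixing the type of tree nodes. Widths are integers bounded below by \<open>-1\<close>, so the infimum is a
  minimum; the graph without vertices has treewidth \<open>-1\<close>.
\<close>

definition treewidth :: "'a pair_pre_digraph \<Rightarrow> int" where
  "treewidth G =
    Inf {decomposition_width T B | (T :: nat pair_pre_digraph) B. tree_decomposition G T B}"

end

theory Submission
  imports Defs
begin

text \<open>
  The parts of a partition of \<open>V(G)\<close> are chosen one after another so that every component \<open>C\<close> of
  the unassigned vertices has all its outside neighbours in two parts sharing a bag, and these
  neighbours lie in two disjoint, adjacent, connected sets \<open>A\<close> and \<open>B\<close> avoiding \<open>C\<close>. By Menger's
  theorem, \<open>t\<close> disjoint connections inside \<open>C\<close> between the neighbours of \<open>A\<close> and those of \<open>B\<close> would give a
  $K^{\ast}_{2,t}$ minor, so at most \<open>t - 1\<close> vertices \<open>P\<close> of \<open>C\<close> separate them. A smallest such \<open>P\<close> is the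
  next part. No component of \<open>C - P\<close> sees both \<open>A\<close> and \<open>B\<close>; if it does not see \<open>B\<close>, then \<open>B\<close> may be
  enlarged by \<open>P\<close> and everything on the side of \<open>B\<close>, and this set is connected because \<open>P\<close> is minimal.
\<close>

section \<open>Connected sets and Menger's theorem\<close>

text \<open>The parts become the vertices of \<open>H\<close>, and the factor
  \<open>complete_graph (t - 1)\<close> only numbers the vertices inside a part, so a part must be
  small but need not be connected in \<open>G\<close>. That is the obstacle: a part cannot itself
  serve as a hub of the forbidden minor. Hence each hub is a larger connected set, free to contain
  other parts and even unassigned vertices outside the component at hand; each component has its own
  pair of hubs, and pairs of different components may overlap. The edge required between the hubs is
  the extra edge of \<open>K2_star\<close>. The bound 2 on the treewidth comes from the new bag,
  which holds the new part and the two parts seen by \<open>C\<close>. A component of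
  \<open>C - P\<close> sees at most the new part and one of those two, so the parts that it sees
  share the new bag and the invariant is restored. If \<open>C\<close> sees fewer than two hubs, a
  smallest separator is empty and would make no progress; a single vertex is then taken as the part,
  which fits because \<open>t - 1\<close> is at least 1.\<close>

definition connected_in :: "'a rel \<Rightarrow> 'a set \<Rightarrow> bool" where
  "connected_in E D \<longleftrightarrow> (\<forall>u\<in>D. \<forall>v\<in>D. (u, v) \<in> (Restr E D)\<^sup>*)"

text \<open>\<open>P\<close> may meet \<open>X\<close> and \<open>Y\<close>. Since the closure is
  reflexive, a vertex common to \<open>X\<close> and \<open>Y\<close> is a connection by itself, so
  every separator contains \<open>X \<inter> Y\<close>.\<close>

definition separates :: "'a rel \<Rightarrow> 'a set \<Rightarrow> 'a set \<Rightarrow> 'a set \<Rightarrow> bool" where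
  "separates E P X Y \<longleftrightarrow> (\<forall>x\<in>X - P. \<forall>y\<in>Y - P. (x, y) \<notin> (Restr E (- P))\<^sup>*)"

lemma connected_in_mono: "connected_in E D \<Longrightarrow> E \<subseteq> E' \<Longrightarrow> connected_in E' D"
  unfolding connected_in_def by (meson Int_mono order_refl rtrancl_mono subsetD)

text \<open>This convention lets an absent hub be represented by the empty set.\<close>

lemma connected_in_empty [simp]: "connected_in E {}"
  by (simp add: connected_in_def)

lemma connected_in_singleton [simp]: "connected_in E {v}"
  by (simp add: connected_in_def)

lemma sym_rtrancl_Restr: "sym E \<Longrightarrow> (u, v) \<in> (Restr E D)\<^sup>* \<Longrightarrow> (v, u) \<in> (Restr E D)\<^sup>*"
  by (metis sym_Int sym_def sym_rtrancl mem_Sigma_iff)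

lemma rtrancl_Restr_mono: "(u, v) \<in> (Restr E D)\<^sup>* \<Longrightarrow> D \<subseteq> D' \<Longrightarrow> (u, v) \<in> (Restr E D')\<^sup>*"
  by (rule rtrancl_mono[THEN subsetD, rotated]) auto

lemma rtrancl_closed:
  assumes "(u, v) \<in> R\<^sup>*" "u \<in> Z" "\<And>a b. a \<in> Z \<Longrightarrow> (a, b) \<in> R \<Longrightarrow> b \<in> Z"
  shows "v \<in> Z"
  using assms by (induction rule: rtrancl_induct) auto

lemma connected_in_star:
  assumes "sym E" "r \<in> D" "\<And>v. v \<in> D \<Longrightarrow> (r, v) \<in> (Restr E D)\<^sup>*"
  shows "connected_in E D"
  unfolding connected_in_def using assms sym_rtrancl_Restr[of E] by (metis rtrancl_trans)

lemma connected_in_Un: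
  assumes "sym E" "connected_in E A" "connected_in E B" "a \<in> A" "b \<in> B" "a = b \<or> (a, b) \<in> E"
  shows "connected_in E (A \<union> B)"
proof (rule connected_in_star[where r = a])
  fix v assume "v \<in> A \<union> B"
  then show "(a, v) \<in> (Restr E (A \<union> B))\<^sup>*"
  proof
    assume "v \<in> A"
    then have "(a, v) \<in> (Restr E A)\<^sup>*" using assms by (auto simp: connected_in_def)
    then show ?thesis by (rule rtrancl_Restr_mono) auto
  next
    assume "v \<in> B"
    then have "(b, v) \<in> (Restr E B)\<^sup>*" using assms by (auto simp: connected_in_def)
    then have "(b, v) \<in> (Restr E (A \<union> B))\<^sup>*" by (rule rtrancl_Restr_mono) auto
    moreover have "(a, b) \<in> (Restr E (A \<union> B))\<^sup>*" using assms by blast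
    ultimately show ?thesis by (rule rtrancl_trans[rotated])
  qed
qed (use assms in auto)

lemma connected_in_subset:
  assumes "connected_in (Restr E Z) D" "s \<in> D" "s \<in> Z"
  shows "D \<subseteq> Z"
proof
  fix v assume "v \<in> D"
  then have "(s, v) \<in> (Restr (Restr E Z) D)\<^sup>*" using assms by (auto simp: connected_in_def)
  then show "v \<in> Z" by (rule rtrancl_closed) (use assms in auto)
qed

definition linked :: "'a rel \<Rightarrow> 'a set \<Rightarrow> 'a set \<Rightarrow> 'i set \<Rightarrow> ('i \<Rightarrow> 'a set) \<Rightarrow> bool" where
  "linked E X Y I d \<longleftrightarrow>
    (\<forall>i\<in>I. connected_in E (d i) \<and> d i \<inter> X \<noteq> {} \<and> d i \<inter> Y \<noteq> {}) \<and>
    (\<forall>i\<in>I. \<forall>j\<in>I. i \<noteq> j \<longrightarrow> d i \<inter> d j = {})"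

lemma separates_sym:
  assumes "sym E" shows "separates E P X Y \<longleftrightarrow> separates E P Y X"
  using sym_rtrancl_Restr[OF assms] unfolding separates_def by blast

text \<open>Choosing one vertex of \<open>Y\<close> in each of the disjoint sets is injective, hence
  a bijection when there are as many sets as vertices of \<open>Y\<close>. Naming each set after its
  vertex of \<open>Y\<close> lets two linkages be matched along a separator.\<close>

lemma linked_reindex:
  assumes "linked E X Y I d" "finite I" "finite Y" "card I = card Y"
  obtains d' where "linked E X Y Y d'" "\<And>y. y \<in> Y \<Longrightarrow> y \<in> d' y"
proof -
  have "\<forall>i\<in>I. \<exists>y. y \<in> d i \<inter> Y" using assms(1) by (auto simp: linked_def)
  then obtain g where g: "\<And>i. i \<in> I \<Longrightarrow> g i \<in> d i \<inter> Y" by metis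
  have inj: "inj_on g I"
    using g assms(1) unfolding linked_def inj_on_def by (metis IntD1 disjoint_iff)
  have "g ` I = Y"
    using g assms inj by (intro card_subset_eq) (auto simp: card_image)
  then have bij: "bij_betw g I Y" using inj by (simp add: bij_betw_def)
  let ?h = "inv_into I g"
  have h: "?h y \<in> I" "g (?h y) = y" if "y \<in> Y" for y
    using bij that by (auto simp: bij_betw_def inv_into_into f_inv_into_f)
  have "linked E X Y Y (d \<circ> ?h)"
    using assms(1) h unfolding linked_def comp_def by metis
  moreover have "y \<in> (d \<circ> ?h) y" if "y \<in> Y" for y
    using g h that by (metis IntD1 comp_apply)
  ultimately show ?thesis using that by blast
qed

section \<open>Reachable sets and the two sides of a separator\<close>

definition reach :: "'a rel \<Rightarrow> 'a set \<Rightarrow> 'a set \<Rightarrow> 'a set" where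
  "reach E Z X = {v. \<exists>x\<in>X \<inter> Z. (x, v) \<in> (Restr E Z)\<^sup>*}"

lemma reachI: "x \<in> X \<Longrightarrow> x \<in> Z \<Longrightarrow> x \<in> reach E Z X"
  by (auto simp: reach_def)

lemma reach_subset: "reach E Z X \<subseteq> Z"
proof
  fix v assume "v \<in> reach E Z X"
  then obtain x where "x \<in> Z" "(x, v) \<in> (Restr E Z)\<^sup>*" by (auto simp: reach_def)
  then show "v \<in> Z" using rtrancl_closed[of x v "Restr E Z" Z] by auto
qed

lemma reach_step: "u \<in> reach E Z X \<Longrightarrow> (u, v) \<in> E \<Longrightarrow> v \<in> Z \<Longrightarrow> v \<in> reach E Z X"
  using reach_subset[of E Z X] unfolding reach_def
  by (auto intro: rtrancl_into_rtrancl)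

lemma separates_iff_reach:
  assumes "sym E"
  shows "separates E P X Y \<longleftrightarrow> reach E (- P) X \<inter> reach E (- P) Y = {}"
proof
  assume s: "separates E P X Y"
  show "reach E (- P) X \<inter> reach E (- P) Y = {}"
  proof (rule ccontr)
    assume "reach E (- P) X \<inter> reach E (- P) Y \<noteq> {}"
    then obtain v x y where "x \<in> X - P" "y \<in> Y - P" "(x, v) \<in> (Restr E (- P))\<^sup>*"
      "(y, v) \<in> (Restr E (- P))\<^sup>*" by (auto simp: reach_def)
    then show False using s sym_rtrancl_Restr[OF assms] unfolding separates_def
      by (meson rtrancl_trans)
  qed
next
  assume "reach E (- P) X \<inter> reach E (- P) Y = {}"
  then show "separates E P X Y" unfolding separates_def reach_def by blast
qed

text \<open>A walk from \<open>X\<close> that avoids \<open>P\<close> can leave the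
  \<open>X\<close>-side of \<open>S\<close> only through \<open>S\<close> or along the edge from
  \<open>x\<close> to \<open>y\<close>. Both exits lie in \<open>S \<union> {x}\<close>, which
  \<open>P\<close> already cuts off, so the walk never arrives at \<open>Y\<close>. Thus a lower
  bound on separators of the whole graph carries over to each side.\<close>

lemma separates_from_side:
  assumes "sym E" and E': "E' = E - {(x, y), (y, x)}" and S: "separates E' S X Y"
    and x: "x \<in> reach E' (- S) X" and y: "y \<in> reach E' (- S) Y"
    and P: "separates (Restr E' (reach E' (- S) X \<union> S)) P X (S \<union> {x})"
  shows "separates E P X Y"
proof -
  let ?A = "reach E' (- S) X" and ?B = "reach E' (- S) Y"
  let ?E1 = "Restr E' (?A \<union> S)"
  let ?Z = "reach ?E1 (- P) X"
  have "sym E'" using assms(1) E' by (auto simp: sym_def)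
  then have AB: "?A \<inter> ?B = {}" using S separates_iff_reach by blast
  have Z: "?Z \<inter> (S \<union> {x}) = {}"
  proof (rule ccontr)
    assume "?Z \<inter> (S \<union> {x}) \<noteq> {}"
    then obtain v where v: "v \<in> ?Z" "v \<in> S \<union> {x}" by blast
    moreover have "v \<notin> P" using v(1) reach_subset by fastforce
    ultimately show False using P unfolding separates_def reach_def by blast
  qed
  have start: "w \<in> ?Z \<inter> ?A" if "w \<in> X - P" for w
  proof -
    have "w \<in> ?Z" using that by (auto intro: reachI)
    moreover from this have "w \<notin> S" using Z by blast
    ultimately show ?thesis using that by (auto intro: reachI)
  qed
  have step: "v \<in> ?Z \<inter> ?A" if "u \<in> ?Z \<inter> ?A" "(u, v) \<in> Restr E (- P)" for u v
  proof -
    have "u \<noteq> x" "u \<noteq> y" using that Z y AB by blast+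
    then have e: "(u, v) \<in> E'" using that E' by auto
    have "v \<in> ?A \<union> S" using that e reach_step[of u E' "- S" X v] by blast
    then have "(u, v) \<in> ?E1" using e that by blast
    then have "v \<in> ?Z" using that by (intro reach_step[of u ?E1 "- P" X v]) auto
    then show ?thesis using \<open>v \<in> ?A \<union> S\<close> Z by blast
  qed
  show ?thesis unfolding separates_def
  proof (intro ballI notI)
    fix a b assume a: "a \<in> X - P" and b: "b \<in> Y - P" and ab: "(a, b) \<in> (Restr E (- P))\<^sup>*"
    have "b \<in> ?Z \<inter> ?A" by (rule rtrancl_closed[OF ab start[OF a] step])
    moreover from this have "b \<in> ?B" using b Z by (intro reachI) auto
    ultimately show False using AB by blast
  qed
qed

definition separation_bound :: "'a rel \<Rightarrow> nat \<Rightarrow> 'a set \<Rightarrow> 'a set \<Rightarrow> bool" where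
  "separation_bound E k X Y \<longleftrightarrow> (\<forall>P. finite P \<longrightarrow> separates E P X Y \<longrightarrow> k \<le> card P)"

text \<open>The sets of the two sides named by the same \<open>s\<close> in \<open>S\<close> share
  the vertex \<open>s\<close>; the sets named \<open>x\<close> and \<open>y\<close> are joined by
  the edge \<open>xy\<close>, which is why \<open>h\<close> sends \<open>x\<close> to
  \<open>y\<close>.\<close>

lemma menger_glue:
  assumes "sym E" and E': "E' \<subseteq> E" and AB: "A \<inter> B = {}" "A \<inter> S = {}" "B \<inter> S = {}"
    and x: "x \<in> A" and y: "y \<in> B" and xy: "(x, y) \<in> E"
    and d: "linked (Restr E' (A \<union> S)) X (insert x S) (insert x S) d" "\<And>s. s \<in> insert x S \<Longrightarrow> s \<in> d s"
    and e: "linked (Restr E' (B \<union> S)) Y (insert y S) (insert y S) e" "\<And>s. s \<in> insert y S \<Longrightarrow> s \<in> e s"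
  defines "h \<equiv> \<lambda>s. if s = x then y else s"
  shows "linked E X Y (insert x S) (\<lambda>s. d s \<union> e (h s))"
proof -
  have hS: "h s \<in> insert y S" if "s \<in> insert x S" for s using that by (auto simp: h_def)
  have dsub: "d s \<subseteq> A \<union> S" if "s \<in> insert x S" for s
    by (rule connected_in_subset[of E' "A \<union> S" "d s" s]) (use d that x in \<open>auto simp: linked_def\<close>)
  have esub: "e s \<subseteq> B \<union> S" if "s \<in> insert y S" for s
    by (rule connected_in_subset[of E' "B \<union> S" "e s" s]) (use e that y in \<open>auto simp: linked_def\<close>)
  \<comment> \<open>Sets from opposite sides can meet only inside \<open>S\<close>, and a vertex of
    \<open>S\<close> lies in no set but the one named after it.\<close>
  have de: "s = s'" if "s \<in> insert x S" "s' \<in> insert x S" "v \<in> d s" "v \<in> e (h s')" for s s' v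
  proof -
    have "v \<in> S" using dsub[OF that(1)] esub[OF hS[OF that(2)]] that AB by blast
    then have "v = s" using d that unfolding linked_def by (metis disjoint_iff insertCI)
    moreover have "v = h s'" using e that hS[OF that(2)] \<open>v \<in> S\<close> unfolding linked_def
      by (metis disjoint_iff insertCI)
    ultimately show ?thesis using \<open>v \<in> S\<close> AB y by (auto simp: h_def split: if_splits)
  qed
  have inj: "h s \<noteq> h s'" if "s \<in> insert x S" "s' \<in> insert x S" "s \<noteq> s'" for s s'
    using that AB y by (auto simp: h_def)
  have conn: "connected_in E (d s \<union> e (h s))" if s: "s \<in> insert x S" for s
  proof (rule connected_in_Un[where a = s and b = "h s"])
    show "connected_in E (d s)" using d(1) s E' unfolding linked_def
      by (meson connected_in_mono inf.coboundedI1)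
    show "connected_in E (e (h s))" using e(1) hS[OF s] E' unfolding linked_def
      by (meson connected_in_mono inf.coboundedI1)
  qed (use assms(1) d(2) e(2) s hS[OF s] xy in \<open>auto simp: h_def\<close>)
  have disj: "(d s \<union> e (h s)) \<inter> (d s' \<union> e (h s')) = {}"
    if "s \<in> insert x S" "s' \<in> insert x S" "s \<noteq> s'" for s s'
  proof -
    have "d s \<inter> d s' = {}" "e (h s) \<inter> e (h s') = {}"
      using d(1) e(1) that inj[OF that] hS unfolding linked_def by meson+
    then show ?thesis using de[of s s'] de[of s' s] that by blast
  qed
  have "(d s \<union> e (h s)) \<inter> X \<noteq> {} \<and> (d s \<union> e (h s)) \<inter> Y \<noteq> {}" if "s \<in> insert x S" for s
  proof -
    have "d s \<inter> X \<noteq> {}" "e (h s) \<inter> Y \<noteq> {}"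
      using d(1) e(1) that hS[OF that] unfolding linked_def by auto
    then show ?thesis by blast
  qed
  then show ?thesis using conn disj unfolding linked_def by simp
qed

text \<open>
  Paths are replaced by disjoint connected sets, which is all a minor needs. A deleted edge \<open>xy\<close>
  that lowers the connectivity below \<open>k\<close> leaves a separator \<open>S\<close> of size \<open>k - 1\<close>; the induction
  hypothesis links \<open>X\<close> to \<open>S \<union> {x}\<close> and \<open>S \<union> {y}\<close> to \<open>Y\<close> on the two sides of \<open>S\<close>.
\<close>

theorem menger:
  assumes "finite E" "sym E" "irrefl E" "finite X" "finite Y" "separation_bound E k X Y"
  shows "\<exists>I d. finite (I :: 'a set) \<and> card I = k \<and> linked (E :: 'a rel) X Y I d"
  using assms
proof (induction "card E" arbitrary: E X Y rule: less_induct)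
  case less
  note [simp] = less.prems(1,4,5)
  show ?case
  proof (cases "E = {}")
    case True
    \<comment> \<open>Without edges the only connections are single vertices of
      \<open>X \<inter> Y\<close>.\<close>
    have "separates E (X \<inter> Y) X Y" using True by (auto simp: separates_def)
    then have "k \<le> card (X \<inter> Y)" using less.prems(6) by (simp add: separation_bound_def)
    then obtain I where "I \<subseteq> X \<inter> Y" "card I = k" "finite I"
      by (metis obtain_subset_with_card_n)
    then have "linked E X Y I (\<lambda>v. {v})" by (auto simp: linked_def)
    then show ?thesis using \<open>card I = k\<close> \<open>finite I\<close> by blast
  next
    case False
    then obtain x0 y0 where xy0: "(x0, y0) \<in> E" by auto
    define E' where "E' = E - {(x0, y0), (y0, x0)}"
    have cardE': "card E' < card E"
      using xy0 unfolding E'_def by (intro psubset_card_mono) auto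
    have E'_props: "finite E'" "sym E'" "irrefl E'" "E' \<subseteq> E"
      using less.prems(2,3) by (auto simp: E'_def sym_def irrefl_def)
    show ?thesis
    proof (cases "separation_bound E' k X Y")
      case True
      then obtain I d where I: "finite (I :: 'a set)" "card I = k" "linked E' X Y I d"
        using less.hyps[OF cardE' E'_props(1-3) less.prems(4,5)] by blast
      then have "linked E X Y I d" using E'_props(4) connected_in_mono unfolding linked_def by blast
      then show ?thesis using I by blast
    next
      case False
      then obtain S where S: "finite S" "separates E' S X Y" "card S < k"
        by (auto simp: separation_bound_def not_le)
      let ?A = "reach E' (- S) X" and ?B = "reach E' (- S) Y"
      have AB: "?A \<inter> ?B = {}" using S separates_iff_reach[OF E'_props(2)] by blast
      have AS: "?A \<inter> S = {}" "?B \<inter> S = {}" using reach_subset by fastforce+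
      have "\<not> separates E S X Y" using S less.prems(6) by (auto simp: separation_bound_def)
      then obtain a b where ab: "a \<in> X - S" "b \<in> Y - S" "(a, b) \<in> (Restr E (- S))\<^sup>*"
        by (auto simp: separates_def)
      \<comment> \<open>\<open>S\<close> separates after the deletion but not before, so a walk from
        \<open>a\<close> to \<open>b\<close> must leave the \<open>X\<close>-side through the
        deleted edge. Tracing it back from \<open>b\<close> gives the same for the
        \<open>Y\<close>-side; together these orient the edge.\<close>
      have one: "\<exists>x y. (x, y) \<in> {(x0, y0), (y0, x0)} \<and> x \<in> ?A \<and> y \<notin> ?A \<and> y \<notin> S"
      proof (rule ccontr)
        assume n: "\<not> ?thesis"
        have "b \<in> ?A"
        proof (rule rtrancl_closed[OF ab(3)])
          show "a \<in> ?A" using ab by (auto intro: reachI)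
          fix u v assume "u \<in> ?A" "(u, v) \<in> Restr E (- S)"
          then show "v \<in> ?A" using n reach_step[of u E' "- S" X v] by (auto simp: E'_def)
        qed
        moreover have "b \<in> ?B" using ab by (auto intro: reachI)
        ultimately show False using AB by blast
      qed
      have two: "\<exists>x y. (x, y) \<in> {(x0, y0), (y0, x0)} \<and> x \<in> ?B \<and> y \<notin> ?B \<and> y \<notin> S"
      proof (rule ccontr)
        assume n: "\<not> ?thesis"
        have "a \<in> ?B"
        proof (rule rtrancl_closed[OF sym_rtrancl_Restr[OF less.prems(2) ab(3)]])
          show "b \<in> ?B" using ab by (auto intro: reachI)
          fix u v assume "u \<in> ?B" "(u, v) \<in> Restr E (- S)"
          then show "v \<in> ?B" using n reach_step[of u E' "- S" Y v] by (auto simp: E'_def)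
        qed
        moreover have "a \<in> ?A" using ab by (auto intro: reachI)
        ultimately show False using AB by blast
      qed
      obtain x y where xy: "(x, y) \<in> {(x0, y0), (y0, x0)}" "x \<in> ?A" "y \<in> ?B"
        using one two AB by blast
      have xyE: "(x, y) \<in> E" using xy xy0 less.prems(2) by (auto simp: sym_def)
      have E'x: "E' = E - {(x, y), (y, x)}" and E'y: "E' = E - {(y, x), (x, y)}"
        using xy by (auto simp: E'_def)
      have nS: "x \<notin> S" "y \<notin> S" using xy AS by blast+
      \<comment> \<open>Removing the vertex \<open>x\<close> also removes the edge
        \<open>xy\<close>, so \<open>S\<close> and \<open>x\<close> separate in \<open>E\<close>.
        With \<open>card S < k\<close> this forces \<open>card S = k - 1\<close>.\<close>
      have "separates E (insert x S) X Y"
        unfolding separates_def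
      proof (intro ballI notI)
        fix u v assume "u \<in> X - insert x S" "v \<in> Y - insert x S"
          and uv: "(u, v) \<in> (Restr E (- insert x S))\<^sup>*"
        moreover have "Restr E (- insert x S) \<subseteq> Restr E' (- S)" using xy(1) by (auto simp: E'_def)
        then have "(u, v) \<in> (Restr E' (- S))\<^sup>*" using uv rtrancl_mono by blast
        ultimately show False using S(2) unfolding separates_def by blast
      qed
      then have "k \<le> card (insert x S)" using less.prems(6) S(1) by (simp add: separation_bound_def)
      then have k: "card (insert x S) = k" "card (insert y S) = k" using S nS by auto
      let ?E1 = "Restr E' (?A \<union> S)" and ?E2 = "Restr E' (?B \<union> S)"
      have sub: "card ?E1 < card E" "card ?E2 < card E"
        using cardE' card_mono[OF E'_props(1), of ?E1] card_mono[OF E'_props(1), of ?E2] by auto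
      have props: "finite ?E1" "sym ?E1" "irrefl ?E1" "finite ?E2" "sym ?E2" "irrefl ?E2"
        using E'_props by (auto simp: sym_def irrefl_def)
      have "separation_bound ?E1 k X (insert x S)"
        using less.prems(6) separates_from_side[OF less.prems(2) E'x S(2) xy(2,3)]
        by (simp add: separation_bound_def)
      from less.hyps[OF sub(1) props(1-3) less.prems(4) _ this] S(1) obtain I1 d1 where
        1: "finite (I1 :: 'a set)" "card I1 = k" "linked ?E1 X (insert x S) I1 d1"
        by (metis finite_insert)
      obtain d where d: "linked ?E1 X (insert x S) (insert x S) d" "\<And>s. s \<in> insert x S \<Longrightarrow> s \<in> d s"
        using linked_reindex[OF 1(3,1)] 1(2) k S(1) by auto
      have S2: "separates E' S Y X" using S(2) separates_sym[OF E'_props(2)] by blast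
      have "separation_bound ?E2 k Y (insert y S)"
        using less.prems(6) separates_from_side[OF less.prems(2) E'y S2 xy(3,2)]
          separates_sym[OF less.prems(2)]
        by (simp add: separation_bound_def)
      from less.hyps[OF sub(2) props(4-6) less.prems(5) _ this] S(1) obtain I2 d2 where
        2: "finite (I2 :: 'a set)" "card I2 = k" "linked ?E2 Y (insert y S) I2 d2"
        by (metis finite_insert)
      obtain e where e: "linked ?E2 Y (insert y S) (insert y S) e" "\<And>s. s \<in> insert y S \<Longrightarrow> s \<in> e s"
        using linked_reindex[OF 2(3,1)] 2(2) k S(1) by auto
      have "linked E X Y (insert x S) (\<lambda>s. d s \<union> e (if s = x then y else s))"
        by (rule menger_glue[OF less.prems(2) E'_props(4) AB AS xy(2,3) xyE d(1) _ e(1)])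
          (use d(2) e(2) in auto)
      then show ?thesis using k(1) S(1) by (intro exI[of _ "insert x S"] exI conjI) auto
    qed
  qed
qed

section \<open>Minors from branch sets\<close>

lemma pair_graph_iff:
  "pair_graph G \<longleftrightarrow>
    finite (pverts G) \<and> parcs G \<subseteq> pverts G \<times> pverts G \<and> sym (parcs G) \<and> irrefl (parcs G)"
proof
  assume "pair_graph G"
  then interpret pair_graph G .
  have "(x, x) \<notin> parcs G" for x using no_loops' by blast
  then show "finite (pverts G) \<and> parcs G \<subseteq> pverts G \<times> pverts G \<and> sym (parcs G) \<and> irrefl (parcs G)"
    using pair_finite_verts by (auto simp: sym_def irrefl_def intro: arcs_symmetric dest: in_arcsD1 in_arcsD2)
next
  assume r: "finite (pverts G) \<and> parcs G \<subseteq> pverts G \<times> pverts G \<and> sym (parcs G) \<and> irrefl (parcs G)"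
  then have "finite (parcs G)" by (meson finite_SigmaI finite_subset)
  with r show "pair_graph G"
    by unfold_locales (auto simp: irrefl_def symmetric_def)
qed

text \<open>The common form of contractions and renamings: a contraction is the image under a map
  merging two adjacent vertices, so successive contractions become a composition of maps.\<close>

definition graph_image :: "('a \<Rightarrow> 'b) \<Rightarrow> 'a pair_pre_digraph \<Rightarrow> 'b pair_pre_digraph" where
  "graph_image f G =
    \<lparr> pverts = f ` pverts G, parcs = {(f x, f y) | x y. (x, y) \<in> parcs G \<and> f x \<noteq> f y} \<rparr>"

lemma graph_image_simps [simp]:
  "pverts (graph_image f G) = f ` pverts G"
  "parcs (graph_image f G) = {(f x, f y) | x y. (x, y) \<in> parcs G \<and> f x \<noteq> f y}"
  by (simp_all add: graph_image_def)

lemma graph_image_arcI: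
  "(x, y) \<in> parcs G \<Longrightarrow> f x \<noteq> f y \<Longrightarrow> (f x, f y) \<in> parcs (graph_image f G)"
  unfolding graph_image_simps by blast

lemma graph_image_arcE:
  assumes "(p, q) \<in> parcs (graph_image f G)"
  obtains x y where "(x, y) \<in> parcs G" "p = f x" "q = f y" "f x \<noteq> f y"
  using assms unfolding graph_image_simps by blast

lemma graph_image_comp: "graph_image g (graph_image f G) = graph_image (g \<circ> f) G"
proof -
  have "parcs (graph_image g (graph_image f G)) = parcs (graph_image (g \<circ> f) G)"
  proof (intro subset_antisym subrelI)
    fix p q assume "(p, q) \<in> parcs (graph_image g (graph_image f G))"
    then obtain u v where uv: "(u, v) \<in> parcs (graph_image f G)" "p = g u" "q = g v" "g u \<noteq> g v"
      by (rule graph_image_arcE)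
    from uv(1) obtain x y where "(x, y) \<in> parcs G" "u = f x" "v = f y"
      by (rule graph_image_arcE)
    then show "(p, q) \<in> parcs (graph_image (g \<circ> f) G)"
      using uv graph_image_arcI[of x y G "g \<circ> f"] by simp
  next
    fix p q assume "(p, q) \<in> parcs (graph_image (g \<circ> f) G)"
    then obtain x y where xy: "(x, y) \<in> parcs G" "p = (g \<circ> f) x" "q = (g \<circ> f) y"
      "(g \<circ> f) x \<noteq> (g \<circ> f) y"
      by (rule graph_image_arcE)
    then have "(f x, f y) \<in> parcs (graph_image f G)" by (intro graph_image_arcI) auto
    then show "(p, q) \<in> parcs (graph_image g (graph_image f G))"
      using xy graph_image_arcI[of "f x" "f y" "graph_image f G" g] by (simp del: graph_image_simps)
  qed
  then show ?thesis by (simp add: graph_image_def image_comp)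
qed

lemma graph_image_cong:
  assumes "pair_graph G" "\<And>x. x \<in> pverts G \<Longrightarrow> f x = g x"
  shows "graph_image f G = graph_image g G"
proof -
  have "(f x, f y) = (g x, g y)" if "(x, y) \<in> parcs G" for x y
    using assms that by (auto simp: pair_graph_iff)
  then show ?thesis using assms(2) unfolding graph_image_def by (auto, (metis prod.inject)+)
qed

lemma graph_image_id: "pair_graph G \<Longrightarrow> graph_image (\<lambda>x. x) G = G"
  unfolding pair_graph_iff irrefl_def by (intro pair_pre_digraph.equality) auto

lemma pair_graph_image:
  assumes "pair_graph G" shows "pair_graph (graph_image f G)"
proof -
  have "(q, p) \<in> parcs (graph_image f G)" if "(p, q) \<in> parcs (graph_image f G)" for p q
  proof -
    from that obtain x y where xy: "(x, y) \<in> parcs G" "p = f x" "q = f y" "f x \<noteq> f y"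
      by (rule graph_image_arcE)
    then have "(y, x) \<in> parcs G" using assms by (auto simp: pair_graph_iff sym_def)
    then show ?thesis using graph_image_arcI[of y x G f] xy by (simp del: graph_image_simps)
  qed
  then have "sym (parcs (graph_image f G))" by (rule symI)
  then show ?thesis using assms unfolding pair_graph_iff by (auto simp: irrefl_def)
qed

lemma contract_edge_eq_image:
  "contract_edge u v G = graph_image (\<lambda>x. if x = v then u else x) G"
  by (simp add: contract_edge_def graph_image_def Let_def)

lemma digraph_iso_graph_image:
  assumes "pair_graph G" "inj_on f (pverts G)"
  shows "digraph_iso (with_proj G) (with_proj (graph_image f G))"
proof -
  interpret pair_graph G by fact
  have arcs: "parcs G \<subseteq> pverts G \<times> pverts G" "irrefl (parcs G)"
    using assms(1) by (auto simp: pair_graph_iff)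
  let ?h = "\<lparr> iso_verts = f, iso_arcs = map_prod f f, iso_head = snd, iso_tail = fst \<rparr>"
  have "inj_on (map_prod f f) (parcs G)"
    using map_prod_inj_on[OF assms(2) assms(2)] arcs(1) by (rule inj_on_subset)
  then have "pre_digraph.digraph_isomorphism (with_proj G) ?h"
    using assms(2) wf_digraph_axioms by (simp add: pre_digraph.digraph_isomorphism_def)
  moreover have "map_prod f f ` parcs G = parcs (graph_image f G)"
  proof -
    have "f x \<noteq> f y" if "(x, y) \<in> parcs G" for x y
      using that arcs assms(2) by (metis SigmaE2 inj_on_eq_iff irrefl_def subsetD)
    then show ?thesis by force
  qed
  then have "with_proj (graph_image f G) = app_iso ?h (with_proj G)"
    by (simp add: app_iso_def with_proj_def)
  ultimately show ?thesis unfolding digraph_iso_def by blast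
qed

lemma subgraph_with_projI:
  assumes "pair_graph S" "pair_graph G" "pverts S \<subseteq> pverts G" "parcs S \<subseteq> parcs G"
  shows "subgraph (with_proj S) (with_proj G)"
proof -
  interpret S: pair_graph S by fact
  interpret G: pair_graph G by fact
  show ?thesis using assms S.wf_digraph_axioms G.wf_digraph_axioms
    by (auto simp: subgraph_def)
qed

lemma contracts_to_trans:
  assumes "contracts_to M N" "contracts_to G M" shows "contracts_to G N"
  using assms by induction (auto intro: contracts_to.step)

text \<open>The second hypothesis says that the fibres of \<open>f\<close> are connected. As long as
  \<open>f\<close> is not injective, some edge lies inside a fibre; contracting it loses a vertex
  and leaves the image under \<open>f\<close> unchanged.\<close>

lemma contracts_to_fibres:
  assumes "pair_graph S"
    and "\<And>u v. u \<in> pverts S \<Longrightarrow> v \<in> pverts S \<Longrightarrow> f u = f v \<Longrightarrow>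
      (u, v) \<in> (parcs S \<inter> {(x, y). f x = f y})\<^sup>*"
  shows "\<exists>M. contracts_to S M \<and> pair_graph M \<and> inj_on f (pverts M) \<and>
    graph_image f M = graph_image f S"
  using assms
proof (induction "card (pverts S)" arbitrary: S rule: less_induct)
  case less
  show ?case
  proof (cases "inj_on f (pverts S)")
    case True
    then show ?thesis using contracts_to.refl less.prems(1) by blast
  next
    case False
    then obtain u v where uv: "u \<in> pverts S" "v \<in> pverts S" "f u = f v" "u \<noteq> v"
      by (auto simp: inj_on_def)
    then obtain w where w: "(u, w) \<in> parcs S" "f u = f w"
      using less.prems(2)[OF uv(1-3)] by (auto elim: converse_rtranclE)
    define c where "c x = (if x = w then u else x)" for x
    define S' where "S' = contract_edge u w S"
    have S': "S' = graph_image c S" unfolding S'_def contract_edge_eq_image c_def by simp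
    have fin: "finite (pverts S)" and wS: "w \<in> pverts S" and uw: "u \<noteq> w"
      using less.prems(1) w by (auto simp: pair_graph_iff irrefl_def)
    have fc: "f \<circ> c = f" using w(2) by (auto simp: c_def)
    have pS': "pverts S' = pverts S - {w}" using uv wS uw by (auto simp: S' c_def)
    have "card (pverts S') < card (pverts S)"
      using fin wS unfolding pS' by (metis card_Diff1_less)
    moreover have "pair_graph S'" using less.prems(1) unfolding S' by (rule pair_graph_image)
    moreover have "(a, b) \<in> (parcs S' \<inter> {(x, y). f x = f y})\<^sup>*"
      if ab: "a \<in> pverts S'" "b \<in> pverts S'" "f a = f b" for a b
    proof -
      have "(a, b) \<in> (parcs S \<inter> {(x, y). f x = f y})\<^sup>*" using ab less.prems(2) pS' by auto
      \<comment> \<open>The contraction carries the walk along: each step survives or collapses to a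
        point, so the fibres stay connected.\<close>
      then have "(c a, c b) \<in> (parcs S' \<inter> {(x, y). f x = f y})\<^sup>*"
      proof (induction rule: rtrancl_induct)
        case (step y z)
        have "f (c y) = f (c z)" using step(2) fc by (metis (mono_tags) IntD2 case_prodD comp_apply mem_Collect_eq)
        then have "c y = c z \<or> (c y, c z) \<in> parcs S' \<inter> {(x, y). f x = f y}"
          using step(2) by (auto simp: S')
        then show ?case using step(3) by (metis rtrancl.rtrancl_into_rtrancl)
      qed simp
      then show ?thesis using ab pS' by (simp add: c_def)
    qed
    ultimately obtain M where M: "contracts_to S' M" "pair_graph M" "inj_on f (pverts M)"
      "graph_image f M = graph_image f S'" using less.hyps by blast
    have "contracts_to S M"
      using M(1) contracts_to.step[OF contracts_to.refl w(1)] unfolding S'_def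
      by (rule contracts_to_trans)
    moreover have "graph_image f M = graph_image f S"
      unfolding M(4) unfolding S' graph_image_comp fc ..
    ultimately show ?thesis using M by blast
  qed
qed

text \<open>Mapping each vertex to the index of its branch set gives a map whose fibres are the
  branch sets; contracting these fibres leaves a copy of \<open>X\<close>.\<close>

lemma is_minorI:
  fixes X :: "'b pair_pre_digraph" and G :: "'a pair_pre_digraph"
  assumes X: "pair_graph X" and G: "pair_graph G"
    and br: "\<And>i. i \<in> pverts X \<Longrightarrow> D i \<noteq> {} \<and> D i \<subseteq> pverts G \<and> connected_in (parcs G) (D i)"
    and disj: "\<And>i j. i \<in> pverts X \<Longrightarrow> j \<in> pverts X \<Longrightarrow> i \<noteq> j \<Longrightarrow> D i \<inter> D j = {}"
    and adj: "\<And>i j. (i, j) \<in> parcs X \<Longrightarrow> \<exists>x\<in>D i. \<exists>y\<in>D j. (x, y) \<in> parcs G"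
  shows "is_minor X G"
proof -
  define f where "f x = (THE i. i \<in> pverts X \<and> x \<in> D i)" for x
  have f: "f x = i" if "i \<in> pverts X" "x \<in> D i" for x i
    unfolding f_def using that disj by (intro the_equality) blast+
  \<comment> \<open>Edges between branch sets whose indices are not adjacent in \<open>X\<close> are
    dropped, so that the image of \<open>S\<close> is exactly \<open>X\<close> and not a
    supergraph.\<close>
  define S where "S = \<lparr> pverts = (\<Union>i\<in>pverts X. D i),
    parcs = {(x, y) \<in> parcs G. x \<in> (\<Union>i\<in>pverts X. D i) \<and> y \<in> (\<Union>i\<in>pverts X. D i) \<and>
      (f x = f y \<or> (f x, f y) \<in> parcs X)} \<rparr>"
  have Xp: "parcs X \<subseteq> pverts X \<times> pverts X" "sym (parcs X)" "irrefl (parcs X)"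
    using X by (auto simp: pair_graph_iff)
  have Gp: "sym (parcs G)" "irrefl (parcs G)" "finite (pverts G)" using G by (auto simp: pair_graph_iff)
  have sub: "pverts S \<subseteq> pverts G" "parcs S \<subseteq> parcs G" using br by (auto simp: S_def)
  have S: "pair_graph S" unfolding pair_graph_iff
  proof (intro conjI)
    show "finite (pverts S)" using sub Gp finite_subset by blast
    show "sym (parcs S)" using Gp Xp by (auto simp: S_def sym_def)
    show "irrefl (parcs S)" using Gp sub by (auto simp: irrefl_def)
  qed (auto simp: S_def)
  have fib: "(u, v) \<in> (parcs S \<inter> {(x, y). f x = f y})\<^sup>*"
    if uv: "u \<in> pverts S" "v \<in> pverts S" "f u = f v" for u v
  proof -
    obtain i where i: "i \<in> pverts X" "u \<in> D i" using uv by (auto simp: S_def)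
    have v: "v \<in> D i" using uv f i by (auto simp: S_def)
    have "Restr (parcs G) (D i) \<subseteq> parcs S \<inter> {(x, y). f x = f y}"
      using i(1) f by (auto simp: S_def)
    moreover have "(u, v) \<in> (Restr (parcs G) (D i))\<^sup>*"
      using br[OF i(1)] i v by (auto simp: connected_in_def)
    ultimately show ?thesis using rtrancl_mono by blast
  qed
  have img: "graph_image f S = X"
  proof (rule pair_pre_digraph.equality)
    show "pverts (graph_image f S) = pverts X"
    proof
      show "pverts (graph_image f S) \<subseteq> pverts X" using f by (auto simp: S_def)
      show "pverts X \<subseteq> pverts (graph_image f S)"
      proof
        fix i assume i: "i \<in> pverts X"
        then obtain x where "x \<in> D i" using br by blast
        then show "i \<in> pverts (graph_image f S)" using i f[OF i] by (auto simp: S_def image_iff)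
      qed
    qed
    show "parcs (graph_image f S) = parcs X"
    proof
      show "parcs (graph_image f S) \<subseteq> parcs X" by (auto simp: S_def)
      show "parcs X \<subseteq> parcs (graph_image f S)"
      proof
        fix e assume e: "e \<in> parcs X"
        then obtain i j where ij: "e = (i, j)" "i \<in> pverts X" "j \<in> pverts X" "i \<noteq> j"
          using Xp by (cases e) (auto simp: irrefl_def)
        then obtain x y where xy: "x \<in> D i" "y \<in> D j" "(x, y) \<in> parcs G" using adj e by blast
        have "f x = i" "f y = j" using f ij xy by auto
        moreover from this have "(x, y) \<in> parcs S" using xy ij e by (auto simp: S_def)
        ultimately show "e \<in> parcs (graph_image f S)" using ij by auto
      qed
    qed
  qed simp
  obtain M where M: "contracts_to S M" "pair_graph M" "inj_on f (pverts M)" "graph_image f M = X"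
    using contracts_to_fibres[OF S, of f] fib img by auto
  \<comment> \<open>The definition of a minor asks for an isomorphism from \<open>X\<close> to
    \<open>M\<close>, so the injective map \<open>f\<close> has to be inverted.\<close>
  let ?g = "inv_into (pverts M) f"
  have "graph_image ?g X = graph_image (?g \<circ> f) M" unfolding M(4)[symmetric] graph_image_comp ..
  also have "\<dots> = graph_image (\<lambda>x. x) M" using M by (intro graph_image_cong) auto
  also have "\<dots> = M" using M graph_image_id by blast
  finally have "M = graph_image ?g X" ..
  moreover have "inj_on ?g (pverts X)" unfolding M(4)[symmetric] by (simp add: inj_on_inv_into)
  ultimately have "digraph_iso (with_proj X) (with_proj M)"
    using digraph_iso_graph_image[OF X] by metis
  then show ?thesis unfolding is_minor_def
    using S M(1) subgraph_with_projI[OF S G sub] by blast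
qed

lemma pair_graph_K2_star: "pair_graph (K2_star t)"
  by (auto simp: pair_graph_iff K2_star_def sym_def irrefl_def)

text \<open>\<open>A\<close> and \<open>B\<close> are the hubs and the linked sets the other
  \<open>t\<close> branch sets: each meets \<open>X\<close> and \<open>Y\<close>, and so has a
  neighbour in both hubs.\<close>

lemma K2_star_is_minorI:
  assumes G: "pair_graph G"
    and A: "connected_in (parcs G) A" "A \<subseteq> pverts G"
    and B: "connected_in (parcs G) B" "B \<subseteq> pverts G"
    and AB: "A \<inter> B = {}" "a \<in> A" "b \<in> B" "(a, b) \<in> parcs G"
    and d: "linked (parcs G) X Y I d" "finite I" "card I = t"
    and X: "\<And>i x. i \<in> I \<Longrightarrow> x \<in> d i \<inter> X \<Longrightarrow> \<exists>a\<in>A. (a, x) \<in> parcs G"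
    and Y: "\<And>i y. i \<in> I \<Longrightarrow> y \<in> d i \<inter> Y \<Longrightarrow> \<exists>b\<in>B. (b, y) \<in> parcs G"
    and sub: "\<And>i. i \<in> I \<Longrightarrow> d i \<subseteq> pverts G - A - B"
  shows "is_minor (K2_star t) G"
proof -
  have "card {2..<t + 2} = card I" using d by simp
  then obtain g where g: "bij_betw g {2..<t + 2} I"
    using d(2) finite_same_card_bij by (metis finite_atLeastLessThan)
  define D where "D j = (if j = 0 then A else if j = 1 then B else d (g j))" for j :: nat
  have D: "D 0 = A" "D 1 = B" "D (Suc 0) = B" by (simp_all add: D_def)
  have Dg: "D j = d (g j)" "g j \<in> I" if "j \<in> {2..<t + 2}" for j
    using that g by (auto simp: D_def bij_betw_def)
  have sym: "sym (parcs G)" using G by (simp add: pair_graph_iff)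
  have meets: "d i \<inter> X \<noteq> {}" "d i \<inter> Y \<noteq> {}" "connected_in (parcs G) (d i)" if "i \<in> I" for i
    using d(1) that by (auto simp: linked_def)
  have nA: "\<exists>x\<in>A. \<exists>y\<in>d i. (x, y) \<in> parcs G" if "i \<in> I" for i
    using X[OF that] meets(1)[OF that] by blast
  have nB: "\<exists>x\<in>B. \<exists>y\<in>d i. (x, y) \<in> parcs G" if "i \<in> I" for i
    using Y[OF that] meets(2)[OF that] by blast
  have verts: "pverts (K2_star t) = {0, 1} \<union> {2..<t + 2}" by (simp add: K2_star_def)
  have adj: "\<exists>x\<in>D i. \<exists>y\<in>D j. (x, y) \<in> parcs G"
    if ij: "i \<in> {0, 1}" "j \<in> insert 1 {2..<t + 2}" "i \<noteq> j" for i j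
  proof -
    consider "i = 0" "j = 1" | "i = 0" "j \<in> {2..<t + 2}" | "i = 1" "j \<in> {2..<t + 2}"
      using ij by auto
    then show ?thesis
    proof cases
      case 1
      then show ?thesis using AB D by auto
    next
      case 2
      then show ?thesis using nA Dg D by simp
    next
      case 3
      then show ?thesis using nB Dg D by simp
    qed
  qed
  show ?thesis
  proof (rule is_minorI[OF pair_graph_K2_star G, where D = D])
    fix i assume "i \<in> pverts (K2_star t)"
    then consider "i = 0" | "i = 1" | "i \<in> {2..<t + 2}" by (auto simp: verts)
    then show "D i \<noteq> {} \<and> D i \<subseteq> pverts G \<and> connected_in (parcs G) (D i)"
    proof cases
      case 3
      then have "d (g i) \<noteq> {}" "d (g i) \<subseteq> pverts G" "connected_in (parcs G) (d (g i))"
        using meets[OF Dg(2)] sub[OF Dg(2)] by blast+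
      then show ?thesis using Dg(1)[OF 3] by simp
    qed (use A B AB D in auto)
  next
    fix i j assume "i \<in> pverts (K2_star t)" "j \<in> pverts (K2_star t)" "i \<noteq> j"
    have *: "D i \<inter> D j = {}" if ij: "i < j" "j \<in> insert 1 {2..<t + 2}" for i j
    proof -
      consider "i = 0" "j = 1" | "i = 0" "j \<in> {2..<t + 2}" | "i = 1" "j \<in> {2..<t + 2}" |
        "i \<in> {2..<t + 2}" "j \<in> {2..<t + 2}" using ij by (cases "i = 0 \<or> i = 1") auto
      then show ?thesis
      proof cases
        case 1
        then show ?thesis using D AB by simp
      next
        case 2
        then show ?thesis using D(1) Dg(1)[OF 2(2)] sub[OF Dg(2)[OF 2(2)]] by auto
      next
        case 3
        then show ?thesis using D(2) Dg(1)[OF 3(2)] sub[OF Dg(2)[OF 3(2)]] by auto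
      next
        case 4
        then have "g i \<noteq> g j" using g ij by (metis bij_betw_iff_bijections less_irrefl)
        then show ?thesis using d(1) Dg 4 by (auto simp: linked_def)
      qed
    qed
    show "D i \<inter> D j = {}"
    proof (cases "i < j")
      case True then show ?thesis using * \<open>j \<in> _\<close> verts by auto
    next
      case False
      then have "D j \<inter> D i = {}" using * \<open>i \<in> _\<close> \<open>i \<noteq> j\<close> verts by auto
      then show ?thesis by blast
    qed
  next
    fix i j assume "(i, j) \<in> parcs (K2_star t)"
    then consider "i \<in> {0, 1}" "j \<in> insert 1 {2..<t + 2}" "i \<noteq> j"
      | "j \<in> {0, 1}" "i \<in> insert 1 {2..<t + 2}" "j \<noteq> i"
      by (auto simp: K2_star_def)
    then show "\<exists>x\<in>D i. \<exists>y\<in>D j. (x, y) \<in> parcs G"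
    proof cases
      case 2
      then obtain x y where "x \<in> D j" "y \<in> D i" "(x, y) \<in> parcs G" using adj by meson
      then show ?thesis using symD[OF sym] by blast
    qed (rule adj)
  qed
qed

section \<open>Tree decompositions from parent functions\<close>

lemma connected_induceI:
  assumes "I \<noteq> {}" "connected_in (parcs T) I"
  shows "Digraph_Component.connected (with_proj T \<restriction> I)"
proof -
  have ends: "arcs_ends (with_proj T \<restriction> I) = Restr (parcs T) I"
    by (auto simp: arcs_ends_conv induce_subgraph_def)
  have "(u, v) \<in> rtrancl_on I ((arcs_ends (with_proj T \<restriction> I))\<^sup>s)" if uv: "u \<in> I" "v \<in> I" for u v
  proof -
    have "(u, v) \<in> (Restr (parcs T) I)\<^sup>*" using assms uv by (auto simp: connected_in_def)
    then show ?thesis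
    proof (induction rule: rtrancl_induct)
      case base
      show ?case using uv by (intro rtrancl_on_refl)
    next
      case (step y z)
      then show ?case unfolding ends
        by (intro rtrancl_on_into_rtrancl_on[OF step.IH[unfolded ends]]) (auto simp: symcl_def)
    qed
  qed
  then show ?thesis using assms(1) unfolding connected_conv by simp
qed

text \<open>With parents smaller than their children, connectivity follows by descending to the root
  and acyclicity by looking at a largest vertex.\<close>

definition parent_tree :: "nat \<Rightarrow> (nat \<Rightarrow> nat) \<Rightarrow> nat pair_pre_digraph" where
  "parent_tree n p = \<lparr> pverts = {..<n},
    parcs = {(i, j). i < n \<and> j < n \<and> (0 < i \<and> j = p i \<or> 0 < j \<and> i = p j)} \<rparr>"

lemma parent_tree_arc_iff:
  "(i, j) \<in> parcs (parent_tree n p) \<longleftrightarrow>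
    i < n \<and> j < n \<and> (0 < i \<and> j = p i \<or> 0 < j \<and> i = p j)"
  by (simp add: parent_tree_def)

lemma pcas_nth:
  assumes "pcas u es v" "Suc k < length es"
  shows "snd (es ! k) = fst (es ! Suc k)"
  using assms
proof (induction es arbitrary: u k)
  case (Cons e es)
  then show ?case by (cases k; cases es) auto
qed simp

lemma pcas_last: "pcas u es v \<Longrightarrow> es \<noteq> [] \<Longrightarrow> snd (last es) = v"
  by (induction es arbitrary: u) auto

text \<open>Cyclic indices make the successor of the last arc the first one, so the largest vertex
  of a cycle needs no special position.\<close>

lemma closed_walk_nth:
  assumes "pcas u es u" "k < length es"
  shows "snd (es ! k) = fst (es ! (Suc k mod length es))"
proof (cases "Suc k < length es")
  case True
  then show ?thesis using pcas_nth[OF assms(1)] by simp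
next
  case False
  then have k: "Suc k = length es" and ne: "es \<noteq> []" using assms by auto
  have "fst (es ! 0) = u" using assms(1) ne by (cases es) auto
  moreover have "snd (es ! k) = u" using pcas_last[OF assms(1) ne] k ne
    by (metis diff_Suc_1 last_conv_nth)
  ultimately show ?thesis using k by simp
qed

text \<open>
  The two arcs of a cycle at its largest vertex both join it to its parent, so a cycle of length at
  least 3 would visit that parent twice.
\<close>

lemma parent_tree_acyclic:
  assumes p: "\<And>i. 0 < i \<Longrightarrow> i < n \<Longrightarrow> p i < i"
    and c: "pre_digraph.cycle (with_proj (parent_tree n p)) es" and len: "3 \<le> length es"
  shows False
proof -
  let ?m = "length es"
  obtain u where u: "pcas u es u" "distinct (tl (pawalk_verts u es))"
    "set es \<subseteq> parcs (parent_tree n p)"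
    using c by (auto simp: pre_digraph.cycle_def pre_digraph.awalk_def cas_with_proj_eq
      awalk_verts_with_proj_eq)
  have tl: "tl (pawalk_verts u es) = map snd es" if "pcas u es v" for u v
    using that
  proof (induction es arbitrary: u)
    case (Cons e es)
    then show ?case by (cases es) auto
  qed simp
  have dist: "distinct (map snd es)" using u tl by metis
  define M where "M = Max (set (map snd es))"
  have "M \<in> set (map snd es)" unfolding M_def by (rule Max_in) (use len in auto)
  then obtain k where k: "k < ?m" "snd (es ! k) = M" by (auto simp: in_set_conv_nth)
  have le: "snd (es ! j) \<le> M" if "j < ?m" for j
    unfolding M_def using that by (intro Max_ge) auto
  \<comment> \<open>Arc \<open>k\<close> enters \<open>M\<close>, arc \<open>k1\<close> leaves it,
    and \<open>k0\<close> is the arc before \<open>k\<close>; adding \<open>?m - 1\<close> steps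
    back cyclically without truncated subtraction.\<close>
  define k1 where "k1 = Suc k mod ?m"
  define k0 where "k0 = (k + (?m - 1)) mod ?m"
  have "0 < ?m" using len by linarith
  then have km: "k0 < ?m" "k1 < ?m" unfolding k0_def k1_def by (rule mod_less_divisor)+
  have k0k: "Suc k0 mod ?m = k"
  proof -
    have "Suc k0 mod ?m = (k + (?m - 1) + 1) mod ?m" unfolding k0_def by (simp add: mod_Suc_eq)
    also have "k + (?m - 1) + 1 = k + ?m" using len by linarith
    finally show ?thesis using k by simp
  qed
  \<comment> \<open>Equality would make \<open>k\<close> and \<open>k + 2\<close> congruent modulo
    the length, which is at least 3.\<close>
  have ne: "k0 \<noteq> k1"
  proof
    assume "k0 = k1"
    then have "k = Suc (Suc k mod ?m) mod ?m" using k0k by (simp add: k1_def)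
    then have "k = (k + 2) mod ?m" by (simp add: mod_Suc_eq)
    then show False using k len
      by (cases "k + 2 < ?m") (auto simp: mod_if split: if_splits)
  qed
  have arc: "es ! j \<in> parcs (parent_tree n p)" if "j < ?m" for j
    using u(3) that by (meson nth_mem subsetD)
  have f1: "fst (es ! k1) = M" using closed_walk_nth[OF u(1) k(1)] k(2) by (simp add: k1_def)
  have f0: "fst (es ! k) = snd (es ! k0)" using closed_walk_nth[OF u(1) km(1)] k0k by simp
  \<comment> \<open>If \<open>M\<close> were instead the parent of \<open>j\<close>, then
    \<open>M < j\<close>.\<close>
  have parent: "j = p M" if "(M, j) \<in> parcs (parent_tree n p)" "j \<le> M" for j
    using that p[of j] by (auto simp: parent_tree_def)
  have "snd (es ! k1) = p M"
    using parent[of "snd (es ! k1)"] arc[OF km(2)] le[OF km(2)] f1 by (metis prod.collapse)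
  moreover have "(snd (es ! k0), M) \<in> parcs (parent_tree n p)"
    using arc[OF k(1)] f0 k(2) by (metis prod.collapse)
  then have "(M, snd (es ! k0)) \<in> parcs (parent_tree n p)" by (auto simp: parent_tree_def)
  then have "snd (es ! k0) = p M" using parent le[OF km(1)] by blast
  ultimately have "map snd es ! k0 = map snd es ! k1" using km by simp
  then show False using dist ne km by (metis length_map nth_eq_iff_index_eq)
qed

lemma pair_graph_parent_tree:
  assumes "\<And>i. 0 < i \<Longrightarrow> i < n \<Longrightarrow> p i < i"
  shows "pair_graph (parent_tree n p)"
proof -
  have "0 < i \<and> i < n \<and> i = p i" if "(i, i) \<in> parcs (parent_tree n p)" for i
    using that unfolding parent_tree_arc_iff by blast
  then have "irrefl (parcs (parent_tree n p))" using assms by (metis irreflI less_irrefl)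
  then show ?thesis by (auto simp: pair_graph_iff parent_tree_def sym_def)
qed

text \<open>From any vertex of \<open>I\<close>, following parents stays in \<open>I\<close> and
  decreases until it stops at \<open>r\<close>.\<close>

lemma parent_tree_connected_in:
  assumes p: "\<And>i. 0 < i \<Longrightarrow> i < n \<Longrightarrow> p i < i" and "r \<in> I" "I \<subseteq> {..<n}"
    and I: "\<And>i. i \<in> I \<Longrightarrow> i \<noteq> r \<Longrightarrow> 0 < i \<and> p i \<in> I"
  shows "connected_in (parcs (parent_tree n p)) I"
proof (rule connected_in_star[where r = r])
  show s: "sym (parcs (parent_tree n p))" by (auto simp: parent_tree_def sym_def)
  fix v assume "v \<in> I"
  then show "(r, v) \<in> (Restr (parcs (parent_tree n p)) I)\<^sup>*"
  proof (induction v rule: less_induct)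
    case (less v)
    show ?case
    proof (cases "v = r")
      case False
      then have v: "0 < v" "p v \<in> I" "v < n" using less.prems I assms(3) by auto
      then have "p v < v" using p by blast
      then have "(r, p v) \<in> (Restr (parcs (parent_tree n p)) I)\<^sup>*" using less.IH v by blast
      moreover have "(p v, v) \<in> Restr (parcs (parent_tree n p)) I"
        using v less.prems \<open>p v < v\<close> by (auto simp: parent_tree_def)
      ultimately show ?thesis by (rule rtrancl_into_rtrancl)
    qed simp
  qed
qed (fact assms(2))

lemma undirected_tree_parent_tree:
  assumes "0 < n" and p: "\<And>i. 0 < i \<Longrightarrow> i < n \<Longrightarrow> p i < i"
  shows "undirected_tree (parent_tree n p)"
proof -
  have "connected_in (parcs (parent_tree n p)) {..<n}"
    by (rule parent_tree_connected_in[of n p 0]) (use assms p in \<open>auto intro: less_trans\<close>)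
  then have "Digraph_Component.connected (with_proj (parent_tree n p) \<restriction> {..<n})"
    using assms(1) by (intro connected_induceI) auto
  moreover have "with_proj (parent_tree n p) \<restriction> {..<n} = with_proj (parent_tree n p)"
    by (auto simp: induce_subgraph_def with_proj_def parent_tree_def)
  ultimately show ?thesis
    using pair_graph_parent_tree[of n p] parent_tree_acyclic[of n p] p
    unfolding undirected_tree_def by (metis (full_types))
qed

lemma treewidth_le:
  fixes T :: "nat pair_pre_digraph"
  assumes "tree_decomposition G T B" "decomposition_width T B \<le> k"
  shows "treewidth G \<le> k"
proof -
  \<comment> \<open>For integers, an infimum is a lower bound only if the set is bounded below; here
    \<open>- 1\<close> bounds it.\<close>
  have "bdd_below {decomposition_width T B | (T :: nat pair_pre_digraph) B. tree_decomposition G T B}"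
  proof (rule bdd_belowI)
    fix w assume "w \<in> {decomposition_width T B | (T :: nat pair_pre_digraph) B. tree_decomposition G T B}"
    then obtain T :: "nat pair_pre_digraph" and B where
      w: "w = decomposition_width T B" "tree_decomposition G T B" by blast
    then have "finite (pverts T)" "pverts T \<noteq> {}"
      unfolding tree_decomposition_def undirected_tree_def pair_graph_iff connected_conv
      with_proj_simps by blast+
    then obtain i where "i \<in> pverts T" by blast
    then have "int (card (B i)) \<le> Max ((\<lambda>i. int (card (B i))) ` pverts T)"
      using \<open>finite (pverts T)\<close> by (intro Max_ge) auto
    then show "- 1 \<le> w" unfolding w decomposition_width_def by linarith
  qed
  then have "treewidth G \<le> decomposition_width T B"
    unfolding treewidth_def using assms(1) by (intro cInf_lower) auto
  then show ?thesis using assms(2) by linarith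
qed

text \<open>Nodes and vertices share their numbering: node \<open>i\<close> introduces vertex
  \<open>i\<close> and inherits the rest of its bag from its parent. So \<open>v\<close> is the
  smallest node whose bag contains \<open>v\<close>.\<close>

definition bag_tree :: "nat \<Rightarrow> nat \<Rightarrow> (nat \<Rightarrow> nat) \<Rightarrow> (nat \<Rightarrow> nat set) \<Rightarrow> bool" where
  "bag_tree w n p \<beta> \<longleftrightarrow> 0 < n \<and>
    (\<forall>i<n. i \<in> \<beta> i \<and> \<beta> i \<subseteq> {..i} \<and> card (\<beta> i) \<le> w + 1) \<and>
    (\<forall>i<n. 0 < i \<longrightarrow> p i < i \<and> \<beta> i - {i} \<subseteq> \<beta> (p i))"

text \<open>All pairs sharing a bag are made adjacent, the most edges that these bags permit, so an
  edge of \<open>G\<close> between two parts only requires a common bag.\<close>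

definition bag_graph :: "nat \<Rightarrow> (nat \<Rightarrow> nat set) \<Rightarrow> nat pair_pre_digraph" where
  "bag_graph n \<beta> = \<lparr> pverts = {..<n},
    parcs = {(u, v). u < n \<and> v < n \<and> u \<noteq> v \<and> (\<exists>i<n. u \<in> \<beta> i \<and> v \<in> \<beta> i)} \<rparr>"

lemma pair_graph_bag_graph: "pair_graph (bag_graph n \<beta>)"
  by (auto simp: pair_graph_iff bag_graph_def sym_def irrefl_def)

text \<open>A node other than \<open>v\<close> whose bag contains \<open>v\<close> inherited it from
  its parent, so these nodes form a subtree rooted at \<open>v\<close>.\<close>

lemma treewidth_bag_graph:
  assumes "bag_tree w n p \<beta>"
  shows "treewidth (bag_graph n \<beta>) \<le> int w"
proof (rule treewidth_le)
  let ?T = "parent_tree n p"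
  have n: "0 < n" and b: "\<And>i. i < n \<Longrightarrow> i \<in> \<beta> i" "\<And>i. i < n \<Longrightarrow> \<beta> i \<subseteq> {..i}"
    "\<And>i. i < n \<Longrightarrow> card (\<beta> i) \<le> w + 1"
    and p: "\<And>i. 0 < i \<Longrightarrow> i < n \<Longrightarrow> p i < i" "\<And>i. 0 < i \<Longrightarrow> i < n \<Longrightarrow> \<beta> i - {i} \<subseteq> \<beta> (p i)"
    using assms by (auto simp: bag_tree_def)
  have verts: "pverts ?T = {..<n}" by (simp add: parent_tree_def)
  have conn: "Digraph_Component.connected (with_proj ?T \<restriction> {i \<in> pverts ?T. v \<in> \<beta> i})"
    if v: "v < n" for v
  proof (intro connected_induceI parent_tree_connected_in[where r = v])
    fix i assume i: "i \<in> {i \<in> pverts ?T. v \<in> \<beta> i}" "i \<noteq> v"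
    then have "v < i" using b(2)[of i] verts by force
    then have "0 < i" "i < n" using i verts by auto
    then show "0 < i \<and> p i \<in> {i \<in> pverts ?T. v \<in> \<beta> i}"
      using p[of i] i verts by auto
  qed (use v b p verts in auto)
  show "tree_decomposition (bag_graph n \<beta>) ?T \<beta>"
    unfolding tree_decomposition_def
  proof (intro conjI)
    show "undirected_tree ?T" using undirected_tree_parent_tree[OF n p(1)] by blast
    show "\<forall>i\<in>pverts ?T. \<beta> i \<subseteq> pverts (bag_graph n \<beta>)"
      using b(2) by (fastforce simp: verts bag_graph_def)
  qed (use conn in \<open>auto simp: verts bag_graph_def\<close>)
  have "Max ((\<lambda>i. int (card (\<beta> i))) ` pverts ?T) \<le> int (w + 1)"
    using n b(3) unfolding verts by (intro Max.boundedI) force+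
  then show "decomposition_width ?T \<beta> \<le> int w" by (simp add: decomposition_width_def)
qed

section \<open>Splitting a guarded component\<close>

definition nbhd :: "'a rel \<Rightarrow> 'a set \<Rightarrow> 'a set" where
  "nbhd E C = {v. v \<notin> C \<and> (\<exists>u\<in>C. (u, v) \<in> E)}"

definition component :: "'a rel \<Rightarrow> 'a set \<Rightarrow> 'a set \<Rightarrow> bool" where
  "component E R C \<longleftrightarrow> C \<noteq> {} \<and> C \<subseteq> R \<and> connected_in E C \<and>
    (\<forall>u\<in>C. \<forall>v\<in>R. (u, v) \<in> E \<longrightarrow> v \<in> C)"

text \<open>
  \<open>A\<close> and \<open>B\<close> are the prospective branch sets of the two hubs of a $K^{\ast}_{2,t}$ minor whose other
  branch sets lie in \<open>C\<close>; either of them may be empty.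
\<close>

definition guards :: "'a pair_pre_digraph \<Rightarrow> 'a set \<Rightarrow> 'a set \<Rightarrow> 'a set \<Rightarrow> bool" where
  "guards G C A B \<longleftrightarrow>
    A \<subseteq> pverts G - C \<and> B \<subseteq> pverts G - C \<and> A \<inter> B = {} \<and>
    connected_in (parcs G) A \<and> connected_in (parcs G) B \<and>
    (A \<noteq> {} \<longrightarrow> B \<noteq> {} \<longrightarrow> (\<exists>a\<in>A. \<exists>b\<in>B. (a, b) \<in> parcs G)) \<and>
    nbhd (parcs G) C \<subseteq> A \<union> B"

lemma guards_sym: "pair_graph G \<Longrightarrow> guards G C A B \<Longrightarrow> guards G C B A"
  unfolding guards_def pair_graph_iff sym_def by (simp add: Int_commute Un_commute) blast

lemma nbhd_component_Diff: "component E (C - P) C' \<Longrightarrow> nbhd E C' \<subseteq> nbhd E C \<union> P"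
  unfolding component_def nbhd_def by blast

lemma component_closed:
  assumes "component E R C" "(u, v) \<in> (Restr E R)\<^sup>*" "u \<in> C"
  shows "v \<in> C"
  using assms(2,3) by (rule rtrancl_closed) (use assms(1) in \<open>auto simp: component_def\<close>)

text \<open>Every vertex of a walk inside \<open>Z\<close> is itself reached, so the walk stays
  within the reachable set. This gives connectivity of that set in itself.\<close>

lemma reach_path:
  assumes "v \<in> reach E Z X"
  obtains x where "x \<in> X \<inter> Z" "(x, v) \<in> (Restr E (reach E Z X))\<^sup>*"
proof -
  obtain x where x: "x \<in> X \<inter> Z" "(x, v) \<in> (Restr E Z)\<^sup>*" using assms by (auto simp: reach_def)
  from x(2) have "(x, v) \<in> (Restr E (reach E Z X))\<^sup>* \<and> v \<in> reach E Z X"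
  proof (induction rule: rtrancl_induct)
    case base
    show ?case using x(1) by (auto intro: reachI)
  next
    case (step y z)
    then have "z \<in> reach E Z X" using reach_step[of y E Z X z] by blast
    then show ?case using step by (blast intro: rtrancl_into_rtrancl)
  qed
  then show ?thesis using x that by blast
qed

lemma component_exists:
  assumes "sym E" "v \<in> R"
  shows "component E R (reach E R {v})"
  unfolding component_def
proof (intro conjI ballI impI)
  show "reach E R {v} \<noteq> {}" "reach E R {v} \<subseteq> R"
    using reachI[of v "{v}" R E] assms(2) reach_subset[of E R] by blast+
  show "connected_in E (reach E R {v})"
  proof (rule connected_in_star[where r = v])
    show "v \<in> reach E R {v}" using assms(2) by (auto intro: reachI)
    fix w assume "w \<in> reach E R {v}"
    then show "(v, w) \<in> (Restr E (reach E R {v}))\<^sup>*" by (rule reach_path) auto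
  qed fact
qed (auto intro: reach_step)

lemma reach_Restr:
  assumes "X \<subseteq> C"
  shows "reach (Restr E C) (- P) X = reach E (C - P) X"
proof -
  have "Restr (Restr E C) (- P) = Restr E (C - P)" by blast
  moreover have "X \<inter> - P = X \<inter> (C - P)" using assms by blast
  ultimately show ?thesis unfolding reach_def by simp
qed

text \<open>Putting \<open>p\<close> back opens a walk from \<open>X\<close> to \<open>Y\<close>. If
  \<open>p\<close> neither lay in \<open>Y\<close> nor touched the \<open>Y\<close>-side, that walk,
  traced from its end in \<open>Y\<close>, could not leave the \<open>Y\<close>-side and would put a
  vertex of \<open>X\<close> there.\<close>

lemma minimal_separator_adjacent:
  assumes "sym E" "X \<subseteq> C" "Y \<subseteq> C" "P \<subseteq> C"
    and sep: "separates (Restr E C) P X Y"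
    and min: "\<not> separates (Restr E C) (P - {p}) X Y"
    and p: "p \<in> P"
  shows "p \<in> Y \<or> (\<exists>w\<in>reach E (C - P) Y. (w, p) \<in> E)"
proof (rule ccontr)
  assume n: "\<not> ?thesis"
  have symR: "sym (Restr E C)" using assms(1) by (auto simp: sym_def)
  let ?B = "reach E (C - P) Y"
  obtain x y where x: "x \<in> X" "x \<notin> P - {p}" and y: "y \<in> Y" "y \<notin> P - {p}"
    and xy: "(x, y) \<in> (Restr (Restr E C) (- (P - {p})))\<^sup>*"
    using min unfolding separates_def by blast
  have "x \<in> ?B"
  proof (rule rtrancl_closed[OF sym_rtrancl_Restr[OF symR xy]])
    show "y \<in> ?B" using y n assms(3) by (intro reachI) auto
    fix a b assume ab: "a \<in> ?B" "(a, b) \<in> Restr (Restr E C) (- (P - {p}))"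
    then have "b \<noteq> p" using n by blast
    then show "b \<in> ?B" using ab by (intro reach_step[of a E "C - P" Y b]) auto
  qed
  moreover from this have "x \<in> reach E (C - P) X"
    using x reach_subset[of E "C - P" Y] by (intro reachI) auto
  ultimately show False
    using sep assms(2,3) unfolding separates_iff_reach[OF symR] by (auto simp: reach_Restr)
qed

text \<open>The component \<open>C'\<close> does not see \<open>B\<close>, so \<open>B\<close> can
  absorb \<open>P\<close> and everything on the \<open>Y\<close>-side of \<open>P\<close>. Every
  vertex of \<open>P\<close> attaches to \<open>B\<close> directly or through that side, by
  minimality. The last two conclusions say which parts \<open>C'\<close> sees: those of
  \<open>A\<close> already seen by \<open>C\<close>, and the new part \<open>P\<close>.\<close>

lemma guards_side:
  fixes G C A B P
  defines "X \<equiv> {x \<in> C. \<exists>a\<in>A. (a, x) \<in> parcs G}" and "Y \<equiv> {y \<in> C. \<exists>b\<in>B. (b, y) \<in> parcs G}"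
  assumes G: "pair_graph G" and g: "guards G C A B" and C: "C \<subseteq> pverts G"
    and ne: "A \<noteq> {}" "B \<noteq> {}" and P: "P \<subseteq> C"
    and sep: "separates (Restr (parcs G) C) P X Y"
    and min: "\<And>p. p \<in> P \<Longrightarrow> \<not> separates (Restr (parcs G) C) (P - {p}) X Y"
    and C': "component (parcs G) (C - P) C'" "C' \<inter> Y = {}"
  shows "guards G C' A (B \<union> P \<union> reach (parcs G) (C - P) Y)"
    and "nbhd (parcs G) C' \<inter> A \<subseteq> nbhd (parcs G) C \<inter> A"
    and "nbhd (parcs G) C' \<inter> (B \<union> P \<union> reach (parcs G) (C - P) Y) \<subseteq> P"
proof -
  let ?E = "parcs G"
  let ?S = "reach ?E (C - P) Y"
  let ?B = "B \<union> P \<union> ?S"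
  have sym: "sym ?E" using G by (simp add: pair_graph_iff)
  have gd: "A \<subseteq> pverts G - C" "B \<subseteq> pverts G - C" "A \<inter> B = {}" "connected_in ?E A"
    "connected_in ?E B" "\<exists>a\<in>A. \<exists>b\<in>B. (a, b) \<in> ?E" "nbhd ?E C \<subseteq> A \<union> B"
    using g ne unfolding guards_def by blast+
  have S: "?S \<subseteq> C - P" by (rule reach_subset)
  have sub: "X \<subseteq> C" "Y \<subseteq> C" by (auto simp: X_def Y_def)
  have C'sub: "C' \<subseteq> C - P" using C' by (simp add: component_def)
  \<comment> \<open>A component of \<open>C - P\<close> meeting the \<open>Y\<close>-side would
    contain the start in \<open>Y\<close> of the walk reaching it.\<close>
  have C'S: "C' \<inter> ?S = {}"
  proof (rule ccontr)
    assume "C' \<inter> ?S \<noteq> {}"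
    then obtain v y where "v \<in> C'" "y \<in> Y" "(y, v) \<in> (Restr ?E (C - P))\<^sup>*"
      by (auto simp: reach_def)
    then have "y \<in> C'" using component_closed[OF C'(1)] sym_rtrancl_Restr[OF sym] by blast
    then show False using C'(2) \<open>y \<in> Y\<close> by blast
  qed
  obtain b0 where b0: "b0 \<in> B" using ne by blast
  have toB: "(b0, b) \<in> (Restr ?E ?B)\<^sup>*" if "b \<in> B" for b
  proof -
    have "(b0, b) \<in> (Restr ?E B)\<^sup>*" using gd(5) b0 that by (auto simp: connected_in_def)
    then show ?thesis by (rule rtrancl_Restr_mono) auto
  qed
  have toY: "(b0, y) \<in> (Restr ?E ?B)\<^sup>*" if y: "y \<in> Y" "y \<in> ?B" for y
  proof -
    obtain b where b: "b \<in> B" "(b, y) \<in> ?E" using y(1) by (auto simp: Y_def)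
    then have "(b, y) \<in> Restr ?E ?B" using y by blast
    then show ?thesis using toB[OF b(1)] by (rule rtrancl_into_rtrancl[rotated])
  qed
  have toS: "(b0, v) \<in> (Restr ?E ?B)\<^sup>*" if v: "v \<in> ?S" for v
  proof -
    obtain y where y: "y \<in> Y \<inter> (C - P)" "(y, v) \<in> (Restr ?E ?S)\<^sup>*" using v by (rule reach_path)
    from y(2) have "(y, v) \<in> (Restr ?E ?B)\<^sup>*" by (rule rtrancl_Restr_mono) auto
    moreover have "y \<in> ?S" using y by (intro reachI) auto
    then have "(b0, y) \<in> (Restr ?E ?B)\<^sup>*" using toY y by blast
    ultimately show ?thesis by (rule rtrancl_trans[rotated])
  qed
  have toP: "(b0, p) \<in> (Restr ?E ?B)\<^sup>*" if p: "p \<in> P" for p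
    using minimal_separator_adjacent[OF sym sub P sep min[OF p] p]
  proof
    assume "p \<in> Y"
    then show ?thesis using toY p by blast
  next
    assume "\<exists>w\<in>?S. (w, p) \<in> ?E"
    then obtain w where w: "w \<in> ?S" "(w, p) \<in> ?E" by blast
    then have "(w, p) \<in> Restr ?E ?B" using p by blast
    then show ?thesis using toS[OF w(1)] by (rule rtrancl_into_rtrancl[rotated])
  qed
  have connB: "connected_in ?E ?B"
    by (rule connected_in_star[OF sym, of b0]) (use b0 toB toS toP in auto)
  have nb: "nbhd ?E C' \<subseteq> nbhd ?E C \<union> P" using C'(1) by (rule nbhd_component_Diff)
  show "guards G C' A ?B" unfolding guards_def
  proof (intro conjI impI)
    show "A \<inter> ?B = {}" using gd P S by blast
    show "?B \<subseteq> pverts G - C'" using gd(2) P C S C'sub C'S by blast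
    show "\<exists>a\<in>A. \<exists>b\<in>?B. (a, b) \<in> ?E" using gd(6) by blast
  qed (use gd C'sub connB nb in blast)+
  show "nbhd ?E C' \<inter> A \<subseteq> nbhd ?E C \<inter> A" using nb gd P by blast
  have "nbhd ?E C' \<inter> B = {}"
  proof (rule ccontr)
    assume "nbhd ?E C' \<inter> B \<noteq> {}"
    then obtain u b where ub: "b \<in> B" "u \<in> C'" "(u, b) \<in> ?E" by (auto simp: nbhd_def)
    then have "u \<in> Y" using C'sub symD[OF sym ub(3)] by (auto simp: Y_def)
    then show False using C'(2) ub by blast
  qed
  moreover have "nbhd ?E C' \<inter> (C - P) = {}" using C'(1) by (auto simp: nbhd_def component_def)
  ultimately show "nbhd ?E C' \<inter> ?B \<subseteq> P" using S by blast
qed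

text \<open>The unseen set \<open>B\<close> is discarded and the new part \<open>{v}\<close> takes
  its place. Choosing \<open>v\<close> next to \<open>A\<close> supplies the edge demanded between
  the two hubs.\<close>

lemma guards_split_vertex:
  assumes G: "pair_graph G" and g: "guards G C A B" and C: "C \<subseteq> pverts G" "C \<noteq> {}"
    and nB: "nbhd (parcs G) C \<inter> B = {}"
  obtains v where "v \<in> C" "\<And>C'. component (parcs G) (C - {v}) C' \<Longrightarrow>
    \<exists>A'. guards G C' A' {v} \<and> nbhd (parcs G) C' \<inter> A' \<subseteq> nbhd (parcs G) C \<inter> A"
proof -
  let ?E = "parcs G"
  \<comment> \<open>If \<open>C\<close> does not see \<open>A\<close> either, no suitable
    \<open>v\<close> need exist; an empty hub lifts the demand for an edge.\<close>
  define A' where "A' = (if nbhd ?E C \<inter> A = {} then {} else A)"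
  have sym: "sym ?E" using G by (simp add: pair_graph_iff)
  obtain v where v: "v \<in> C" "A' \<noteq> {} \<longrightarrow> (\<exists>a\<in>A'. (a, v) \<in> ?E)"
  proof (cases "nbhd ?E C \<inter> A = {}")
    case True
    then show ?thesis using that C(2) by (auto simp: A'_def)
  next
    case False
    then obtain a v where "a \<in> A" "v \<in> C" "(v, a) \<in> ?E" by (auto simp: nbhd_def)
    then show ?thesis using that[of v] symD[OF sym] False by (auto simp: A'_def)
  qed
  have A': "A' \<subseteq> A" "nbhd ?E C \<subseteq> A'" "connected_in ?E A'"
    using g nB by (auto simp: A'_def guards_def)
  have "guards G C' A' {v} \<and> nbhd ?E C' \<inter> A' \<subseteq> nbhd ?E C \<inter> A"
    if C': "component ?E (C - {v}) C'" for C'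
  proof -
    have nb: "nbhd ?E C' \<subseteq> nbhd ?E C \<union> {v}" using C' by (rule nbhd_component_Diff)
    have "C' \<subseteq> C - {v}" using C' by (simp add: component_def)
    moreover have "A \<subseteq> pverts G - C" using g by (simp add: guards_def)
    ultimately show ?thesis using A' v nb C(1) unfolding guards_def by auto
  qed
  then show ?thesis using that v(1) by blast
qed

text \<open>If one hub is unseen, a single vertex is split off, and \<open>2 \<le> t\<close> gives
  it the required size. Otherwise the minor is excluded through Menger's theorem and a smallest
  separator is used. The disjunction records which old hub survives.\<close>

lemma guards_split:
  assumes t: "2 \<le> t" and G: "pair_graph G" and free: "minor_free (K2_star t) G"
    and g: "guards G C A B" and C: "C \<subseteq> pverts G" "C \<noteq> {}" "connected_in (parcs G) C"
  obtains P where "P \<subseteq> C" "P \<noteq> {}" "card P \<le> t - 1"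
    "\<And>C'. component (parcs G) (C - P) C' \<Longrightarrow>
      \<exists>A' B'. guards G C' A' B' \<and> nbhd (parcs G) C' \<inter> B' \<subseteq> P \<and>
        (nbhd (parcs G) C' \<inter> A' \<subseteq> nbhd (parcs G) C \<inter> A \<or>
         nbhd (parcs G) C' \<inter> A' \<subseteq> nbhd (parcs G) C \<inter> B)"
proof -
  let ?E = "parcs G"
  have sym: "sym ?E" and irr: "irrefl ?E" and E: "?E \<subseteq> pverts G \<times> pverts G" and fin: "finite (pverts G)"
    using G by (auto simp: pair_graph_iff)
  consider "nbhd ?E C \<inter> B = {}" | "nbhd ?E C \<inter> A = {}" |
    "nbhd ?E C \<inter> A \<noteq> {}" "nbhd ?E C \<inter> B \<noteq> {}" by blast
  then show ?thesis
  proof cases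
    case 1
    obtain v where v: "v \<in> C" "\<And>C'. component ?E (C - {v}) C' \<Longrightarrow>
        \<exists>A'. guards G C' A' {v} \<and> nbhd ?E C' \<inter> A' \<subseteq> nbhd ?E C \<inter> A"
      using guards_split_vertex[OF G g C(1,2) 1] by blast
    show ?thesis
    proof (rule that[of "{v}"])
      fix C' assume "component ?E (C - {v}) C'"
      from v(2)[OF this] show "\<exists>A' B'. guards G C' A' B' \<and> nbhd ?E C' \<inter> B' \<subseteq> {v} \<and>
        (nbhd ?E C' \<inter> A' \<subseteq> nbhd ?E C \<inter> A \<or> nbhd ?E C' \<inter> A' \<subseteq> nbhd ?E C \<inter> B)"
        by (meson inf_le2)
    qed (use v t in auto)
  next
    case 2
    obtain v where v: "v \<in> C" "\<And>C'. component ?E (C - {v}) C' \<Longrightarrow>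
        \<exists>A'. guards G C' A' {v} \<and> nbhd ?E C' \<inter> A' \<subseteq> nbhd ?E C \<inter> B"
      using guards_split_vertex[OF G guards_sym[OF G g] C(1,2) 2] by blast
    show ?thesis
    proof (rule that[of "{v}"])
      fix C' assume "component ?E (C - {v}) C'"
      from v(2)[OF this] show "\<exists>A' B'. guards G C' A' B' \<and> nbhd ?E C' \<inter> B' \<subseteq> {v} \<and>
        (nbhd ?E C' \<inter> A' \<subseteq> nbhd ?E C \<inter> A \<or> nbhd ?E C' \<inter> A' \<subseteq> nbhd ?E C \<inter> B)"
        by (meson inf_le2)
    qed (use v t in auto)
  next
    case 3
    then have ne: "A \<noteq> {}" "B \<noteq> {}" by auto
    define X where "X = {x \<in> C. \<exists>a\<in>A. (a, x) \<in> ?E}"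
    define Y where "Y = {y \<in> C. \<exists>b\<in>B. (b, y) \<in> ?E}"
    let ?EC = "Restr ?E C"
    have sub: "X \<subseteq> C" "Y \<subseteq> C" by (auto simp: X_def Y_def)
    have finC: "finite C" "finite X" "finite Y" using C(1) fin sub finite_subset by metis+
    have symC: "sym ?EC" "irrefl ?EC" "finite ?EC"
      using sym irr finC(1) by (auto simp: sym_def irrefl_def)
    have gd: "A \<subseteq> pverts G - C" "B \<subseteq> pverts G - C" "A \<inter> B = {}" "connected_in ?E A"
      "connected_in ?E B" "\<exists>a\<in>A. \<exists>b\<in>B. (a, b) \<in> ?E"
      using g ne unfolding guards_def by blast+
    have "\<not> separation_bound ?EC t X Y"
    proof
      assume "separation_bound ?EC t X Y"
      then obtain I d where I: "finite (I :: 'a set)" "card I = t" "linked ?EC X Y I d"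
        using menger[OF symC(3,1,2) finC(2,3)] by blast
      have dsub: "d i \<subseteq> C" if "i \<in> I" for i
      proof -
        have "d i \<inter> X \<noteq> {}" "connected_in ?EC (d i)" using I(3) that by (auto simp: linked_def)
        moreover from this obtain x where "x \<in> d i" "x \<in> X" by blast
        ultimately show ?thesis using connected_in_subset[of ?E C "d i" x] sub by blast
      qed
      have dsub': "d i \<subseteq> pverts G - A - B" if "i \<in> I" for i
        using dsub[OF that] gd(1,2) C(1) by blast
      obtain a b where ab: "a \<in> A" "b \<in> B" "(a, b) \<in> ?E" using gd by blast
      have L: "linked ?E X Y I d" using I(3) connected_in_mono[of ?EC _ ?E] by (auto simp: linked_def)
      have "is_minor (K2_star t) G"
        by (rule K2_star_is_minorI[OF G gd(4) _ gd(5) _ gd(3) ab L])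
          (use gd(1,2) I dsub' in \<open>auto simp: X_def Y_def\<close>)
      then show False using free by blast
    qed
    then obtain P0 where P0: "finite P0" "separates ?EC P0 X Y" "card P0 < t"
      by (auto simp: separation_bound_def not_le)
    \<comment> \<open>The separator from Menger's theorem may contain vertices outside
      \<open>C\<close>. These are irrelevant to walks inside \<open>C\<close>, so the minimum is
      taken over subsets of \<open>C\<close>.\<close>
    let ?Q = "\<lambda>P. P \<subseteq> C \<and> separates ?EC P X Y"
    have "?Q (P0 \<inter> C)"
    proof -
      have "Restr ?EC (- (P0 \<inter> C)) = Restr ?EC (- P0)" by blast
      then show ?thesis using P0(2) sub unfolding separates_def by auto
    qed
    then obtain P where P: "?Q P" "\<And>P'. ?Q P' \<Longrightarrow> card P \<le> card P'"
      using ex_has_least_nat[of ?Q "P0 \<inter> C" card] by blast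
    have "card P \<le> card (P0 \<inter> C)" using P(2) \<open>?Q (P0 \<inter> C)\<close> by blast
    also have "\<dots> \<le> card P0" using P0(1) by (intro card_mono) auto
    finally have cardP: "card P \<le> t - 1" using P0(3) by linarith
    have finP: "finite P" using P(1) finC finite_subset by blast
    have min: "\<not> separates ?EC (P - {p}) X Y" if "p \<in> P" for p
    proof
      assume "separates ?EC (P - {p}) X Y"
      then have "card P \<le> card (P - {p})" using P by blast
      then show False using card_Diff1_less[OF finP that] by linarith
    qed
    have minY: "\<not> separates ?EC (P - {p}) Y X" if "p \<in> P" for p
      using min[OF that] separates_sym[OF symC(1)] by blast
    have sepY: "separates ?EC P Y X" using P(1) separates_sym[OF symC(1)] by blast
    have XYne: "X \<noteq> {}" "Y \<noteq> {}" using 3 sym unfolding nbhd_def X_def Y_def sym_def by blast+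
    have nosep: "False"
      if D: "separates ?EC P' X Y" "D \<subseteq> C - P'" "connected_in ?E D" "D \<inter> X \<noteq> {}" "D \<inter> Y \<noteq> {}" for P' D
    proof -
      obtain x y where xy: "x \<in> D" "x \<in> X" "y \<in> D" "y \<in> Y" using D by blast
      then have "(x, y) \<in> (Restr ?E D)\<^sup>*" using D by (auto simp: connected_in_def)
      then have "(x, y) \<in> (Restr ?EC (- P'))\<^sup>*"
        by (rule rtrancl_mono[THEN subsetD, rotated]) (use D in blast)
      then show False using D(1,2) xy unfolding separates_def by blast
    qed
    \<comment> \<open>\<open>C\<close> itself is connected and meets both \<open>X\<close> and
      \<open>Y\<close>, so the empty set does not separate; hence each round assigns a
      vertex.\<close>
    have Pne: "P \<noteq> {}" using nosep[of P C] P(1) C(3) XYne sub by auto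
    show ?thesis
    proof (rule that[OF _ Pne cardP])
      show "P \<subseteq> C" using P by blast
      fix C' assume C': "component ?E (C - P) C'"
      show "\<exists>A' B'. guards G C' A' B' \<and> nbhd ?E C' \<inter> B' \<subseteq> P \<and>
        (nbhd ?E C' \<inter> A' \<subseteq> nbhd ?E C \<inter> A \<or> nbhd ?E C' \<inter> A' \<subseteq> nbhd ?E C \<inter> B)"
      \<comment> \<open>By \<open>nosep\<close> the connected set \<open>C'\<close> cannot meet both
        \<open>X\<close> and \<open>Y\<close>; the second case is the first with the hubs
        exchanged.\<close>
      proof (cases "C' \<inter> Y = {}")
        case True
        show ?thesis
          using guards_side[OF G g C(1) ne, of P, folded X_def Y_def] P(1) min C' True by blast
      next
        case False
        then have "C' \<inter> X = {}" using nosep[of P C'] P(1) C' by (auto simp: component_def)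
        then show ?thesis
          using guards_side[OF G guards_sym[OF G g] C(1) ne(2,1), of P, folded X_def Y_def]
            P(1) minY sepY C' by blast
      qed
    qed
  qed
qed

section \<open>Building the partition\<close>

text \<open>
  \<open>R\<close> is the set of vertices that are not yet assigned to a part, and \<open>q\<close> is irrelevant on \<open>R\<close>.
\<close>

definition partial_layout :: "'a pair_pre_digraph \<Rightarrow> nat \<Rightarrow> 'a set \<Rightarrow> nat \<Rightarrow> (nat \<Rightarrow> nat) \<Rightarrow>
    (nat \<Rightarrow> nat set) \<Rightarrow> ('a \<Rightarrow> nat) \<Rightarrow> bool" where
  "partial_layout G m R n p \<beta> q \<longleftrightarrow>
    R \<subseteq> pverts G \<and> bag_tree 2 n p \<beta> \<and>
    (\<forall>x\<in>pverts G - R. q x < n) \<and>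
    (\<forall>j. card {x \<in> pverts G - R. q x = j} \<le> m) \<and>
    (\<forall>x\<in>pverts G - R. \<forall>y\<in>pverts G - R. (x, y) \<in> parcs G \<longrightarrow> (\<exists>i<n. q x \<in> \<beta> i \<and> q y \<in> \<beta> i)) \<and>
    (\<forall>C. component (parcs G) R C \<longrightarrow>
      (\<exists>A B i a b. guards G C A B \<and> i < n \<and> a \<in> \<beta> i \<and> b \<in> \<beta> i \<and>
        q ` (nbhd (parcs G) C \<inter> A) \<subseteq> {a} \<and> q ` (nbhd (parcs G) C \<inter> B) \<subseteq> {b}))"

text \<open>Part 0 is left empty, so that the decomposition tree is nonempty even if \<open>G\<close> has no vertices.\<close>

lemma partial_layout_init:
  assumes "pair_graph G"
  shows "partial_layout G m (pverts G) 1 id (\<lambda>_. {0}) q"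
proof -
  have "guards G C {} {} \<and> nbhd (parcs G) C = {}" if "component (parcs G) (pverts G) C" for C
  proof -
    have "nbhd (parcs G) C = {}"
      using that assms unfolding component_def nbhd_def pair_graph_iff by blast
    then show ?thesis by (simp add: guards_def)
  qed
  then show ?thesis unfolding partial_layout_def bag_tree_def by auto
qed

text \<open>Used with \<open>w = 2\<close> and \<open>S = {a, b}\<close>: two old parts of a common
  bag together with the new one give bags of size 3.\<close>

lemma bag_tree_extend:
  assumes "bag_tree w n p \<beta>" "i < n" "S \<subseteq> \<beta> i" "card S \<le> w"
  shows "bag_tree w (Suc n) (p(n := i)) (\<beta>(n := insert n S))"
proof -
  have b: "\<beta> i \<subseteq> {..i}" using assms(1,2) by (auto simp: bag_tree_def)
  then have "finite S" using assms(3) by (meson finite_atMost finite_subset)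
  then have "card (insert n S) \<le> w + 1" using assms(4) by (simp add: card_insert_if)
  moreover have "S \<subseteq> {..n}" using assms(2,3) b by fastforce
  moreover have "insert n S - {n} \<subseteq> \<beta> i" using assms(3) by blast
  ultimately show ?thesis
    using assms(1,2) unfolding bag_tree_def by (auto simp: less_Suc_eq)
qed

text \<open>The set \<open>P\<close> becomes part \<open>n\<close>, with bag
  \<open>{n, a, b}\<close> hung below the bag \<open>i\<close> that contains both parts seen by
  \<open>C\<close>.\<close>

lemma partial_layout_step:
  assumes t: "2 \<le> t" and G: "pair_graph G" and free: "minor_free (K2_star t) G"
    and L: "partial_layout G (t - 1) R n p \<beta> q" and R: "R \<noteq> {}"
  shows "\<exists>R' n' p' \<beta>' q'. R' \<subset> R \<and> partial_layout G (t - 1) R' n' p' \<beta>' q'"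
proof -
  let ?E = "parcs G" and ?V = "pverts G"
  have sym: "sym ?E" and arcs: "?E \<subseteq> ?V \<times> ?V" and fin: "finite ?V" using G by (auto simp: pair_graph_iff)
  have RV: "R \<subseteq> ?V" and bt: "bag_tree 2 n p \<beta>" and qn: "\<And>x. x \<in> ?V - R \<Longrightarrow> q x < n"
    and fib: "\<And>j. card {x \<in> ?V - R. q x = j} \<le> t - 1"
    and edge: "\<And>x y. x \<in> ?V - R \<Longrightarrow> y \<in> ?V - R \<Longrightarrow> (x, y) \<in> ?E \<Longrightarrow> \<exists>i<n. q x \<in> \<beta> i \<and> q y \<in> \<beta> i"
    and comp: "\<And>C. component ?E R C \<Longrightarrow> \<exists>A B i a b. guards G C A B \<and> i < n \<and> a \<in> \<beta> i \<and> b \<in> \<beta> i \<and>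
        q ` (nbhd ?E C \<inter> A) \<subseteq> {a} \<and> q ` (nbhd ?E C \<inter> B) \<subseteq> {b}"
    using L unfolding partial_layout_def by blast+
  obtain C where C: "component ?E R C" using R component_exists[OF sym] by blast
  have CR: "C \<subseteq> R" "C \<noteq> {}" "connected_in ?E C" "\<And>u v. u \<in> C \<Longrightarrow> v \<in> R \<Longrightarrow> (u, v) \<in> ?E \<Longrightarrow> v \<in> C"
    using C unfolding component_def by blast+
  obtain A B i a b where g: "guards G C A B" and i: "i < n" "a \<in> \<beta> i" "b \<in> \<beta> i"
    and qA: "q ` (nbhd ?E C \<inter> A) \<subseteq> {a}" and qB: "q ` (nbhd ?E C \<inter> B) \<subseteq> {b}"
    using comp[OF C] by (elim exE conjE) (rule that)
  have CV: "C \<subseteq> ?V" using CR RV by blast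
  obtain P where P: "P \<subseteq> C" "P \<noteq> {}" "card P \<le> t - 1"
    and split: "\<And>C'. component ?E (C - P) C' \<Longrightarrow>
      \<exists>A' B'. guards G C' A' B' \<and> nbhd ?E C' \<inter> B' \<subseteq> P \<and>
        (nbhd ?E C' \<inter> A' \<subseteq> nbhd ?E C \<inter> A \<or> nbhd ?E C' \<inter> A' \<subseteq> nbhd ?E C \<inter> B)"
    by (rule guards_split[OF t G free g CV CR(2,3)]) (rule that)
  have PR: "P \<subseteq> R" using P(1) CR(1) by blast
  have finP: "finite P" using PR RV by (rule finite_subset[OF subset_trans fin])
  define q' where "q' x = (if x \<in> P then n else q x)" for x
  define \<beta>' where "\<beta>' = \<beta>(n := insert n {a, b})"
  define p' where "p' = p(n := i)"
  have V': "?V - (R - P) = (?V - R) \<union> P" using PR RV by blast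
  have q'R: "q' x = q x" if "x \<notin> R" for x using that PR by (auto simp: q'_def)
  have \<beta>': "\<beta>' j = \<beta> j" if "j < n" for j using that by (simp add: \<beta>'_def)
  have bt': "bag_tree 2 (Suc n) p' \<beta>'"
    unfolding p'_def \<beta>'_def using bt i by (intro bag_tree_extend) (auto simp: card_insert_if)
  have nbC: "q x \<in> {a, b}" if "x \<in> nbhd ?E C" for x
    using that g qA qB unfolding guards_def by blast
  have edgeP: "\<exists>i<Suc n. q' x \<in> \<beta>' i \<and> q' y \<in> \<beta>' i"
    if "x \<in> P" "y \<in> (?V - R) \<union> P" "(x, y) \<in> ?E" for x y
  proof -
    have "q' y \<in> \<beta>' n"
    proof (cases "y \<in> P")
      case True
      then show ?thesis by (simp add: q'_def \<beta>'_def)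
    next
      case False
      \<comment> \<open>An assigned neighbour of \<open>P\<close> outside \<open>P\<close> borders
        \<open>C\<close>, so its part is \<open>a\<close> or \<open>b\<close> and lies in the new
        bag.\<close>
      then have "y \<in> nbhd ?E C" using that P(1) CR(1) by (auto simp: nbhd_def)
      then show ?thesis using nbC False by (auto simp: q'_def \<beta>'_def)
    qed
    then show ?thesis using that(1) by (intro exI[of _ n]) (simp add: q'_def \<beta>'_def)
  qed
  have edge': "\<exists>i<Suc n. q' x \<in> \<beta>' i \<and> q' y \<in> \<beta>' i"
    if xy: "x \<in> ?V - (R - P)" "y \<in> ?V - (R - P)" "(x, y) \<in> ?E" for x y
  proof -
    consider "x \<in> P" | "y \<in> P" | "x \<in> ?V - R" "y \<in> ?V - R" using xy unfolding V' by blast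
    then show ?thesis
    proof cases
      case 1
      then show ?thesis using edgeP xy unfolding V' by blast
    next
      case 2
      then show ?thesis using edgeP[of y x] xy symD[OF sym] unfolding V' by blast
    next
      case 3
      then obtain j where "j < n" "q x \<in> \<beta> j" "q y \<in> \<beta> j" using edge xy by blast
      then show ?thesis using 3 q'R \<beta>' by (intro exI[of _ j]) auto
    qed
  qed
  have fib': "card {x \<in> ?V - (R - P). q' x = j} \<le> t - 1" for j
  proof (cases "j = n")
    case True
    have "q' x \<noteq> n" if "x \<in> ?V - R" for x using qn[OF that] q'R that by auto
    then have "{x \<in> ?V - (R - P). q' x = j} \<subseteq> P" unfolding V' True by blast
    then show ?thesis using P(3) card_mono[OF finP] by (meson le_trans)
  next
    case False
    then have "{x \<in> ?V - (R - P). q' x = j} = {x \<in> ?V - R. q x = j}"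
      using PR unfolding V' by (auto simp: q'_def)
    then show ?thesis using fib by simp
  qed
  have comp': "\<exists>A B i a b. guards G C' A B \<and> i < Suc n \<and> a \<in> \<beta>' i \<and> b \<in> \<beta>' i \<and>
        q' ` (nbhd ?E C' \<inter> A) \<subseteq> {a} \<and> q' ` (nbhd ?E C' \<inter> B) \<subseteq> {b}"
    if C': "component ?E (R - P) C'" for C'
  \<comment> \<open>A component missing \<open>C\<close> was a component before and keeps its hubs
    and bag; one meeting \<open>C\<close> is a component of \<open>C - P\<close> and uses the new
    bag.\<close>
  proof (cases "C' \<inter> C = {}")
    case True
    have C'sub: "C' \<subseteq> R - P" using C' by (simp add: component_def)
    have "component ?E R C'"
      unfolding component_def
    proof (intro conjI ballI impI)
      fix u v assume uv: "u \<in> C'" "v \<in> R" "(u, v) \<in> ?E"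
      have "v \<notin> C" using CR(4)[of v u] uv symD[OF sym] True C'sub by blast
      then show "v \<in> C'" using C' uv P(1) unfolding component_def by blast
    qed (use C' in \<open>auto simp: component_def\<close>)
    then have nR: "nbhd ?E C' \<inter> R = {}" unfolding component_def nbhd_def by blast
    have img: "q' ` (nbhd ?E C' \<inter> Z) = q ` (nbhd ?E C' \<inter> Z)" for Z
      using q'R nR by (intro image_cong) auto
    obtain A' B' i' a' b' where "guards G C' A' B'" "i' < n" "a' \<in> \<beta> i'" "b' \<in> \<beta> i'"
      "q ` (nbhd ?E C' \<inter> A') \<subseteq> {a'}" "q ` (nbhd ?E C' \<inter> B') \<subseteq> {b'}"
      using comp[OF \<open>component ?E R C'\<close>] by (elim exE conjE) (rule that)
    then show ?thesis using \<beta>' unfolding img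
      by (intro exI[of _ A'] exI[of _ B'] exI[of _ i'] exI[of _ a'] exI[of _ b'] conjI) auto
  next
    case False
    then obtain u where u: "u \<in> C'" "u \<in> C" by blast
    have C'sub: "C' \<subseteq> R - P" "connected_in ?E C'" using C' by (auto simp: component_def)
    have "C' \<subseteq> C"
    proof
      fix v assume "v \<in> C'"
      then have "(u, v) \<in> (Restr ?E C')\<^sup>*" using C'sub u by (auto simp: connected_in_def)
      then have "(u, v) \<in> (Restr ?E R)\<^sup>*" by (rule rtrancl_Restr_mono) (use C'sub in auto)
      then show "v \<in> C" using component_closed[OF C] u by blast
    qed
    then have "component ?E (C - P) C'" using C' CR(1) unfolding component_def by blast
    from split[OF this] obtain A' B' where g': "guards G C' A' B'" "nbhd ?E C' \<inter> B' \<subseteq> P"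
      "nbhd ?E C' \<inter> A' \<subseteq> nbhd ?E C \<inter> A \<or> nbhd ?E C' \<inter> A' \<subseteq> nbhd ?E C \<inter> B"
      by (elim exE conjE) (rule that)
    have nP: "q' x = q x" if "x \<in> nbhd ?E C" for x using that P(1) by (auto simp: q'_def nbhd_def)
    \<comment> \<open>The neighbours of \<open>C'\<close> in \<open>A'\<close> were neighbours of
      \<open>C\<close> in a single old hub, hence lie in a single old part.\<close>
    have "q' ` (nbhd ?E C' \<inter> A') \<subseteq> {a} \<or> q' ` (nbhd ?E C' \<inter> A') \<subseteq> {b}"
      using g'(3) qA qB nP by (auto simp: image_subset_iff subset_iff)
    then obtain c where c: "c \<in> {a, b}" "q' ` (nbhd ?E C' \<inter> A') \<subseteq> {c}" by blast
    have "q' ` (nbhd ?E C' \<inter> B') \<subseteq> {n}" using g'(2) by (auto simp: q'_def)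
    moreover have "c \<in> \<beta>' n" "n \<in> \<beta>' n" using c by (auto simp: \<beta>'_def)
    ultimately show ?thesis using g'(1) c(2)
      by (intro exI[of _ A'] exI[of _ B'] exI[of _ n] exI[of _ c] conjI) auto
  qed
  have "partial_layout G (t - 1) (R - P) (Suc n) p' \<beta>' q'"
    unfolding partial_layout_def
  proof (intro conjI ballI allI impI)
    show "q' x < Suc n" if "x \<in> ?V - (R - P)" for x
      using that qn unfolding V' by (auto simp: q'_def less_Suc_eq)
    show "R - P \<subseteq> ?V" using RV by blast
  qed (fact bt' fib' | rule edge' comp', assumption+)+
  moreover have "R - P \<subset> R" using P(2) PR by blast
  ultimately show ?thesis by blast
qed

lemma layout_exists:
  assumes t: "2 \<le> t" and G: "pair_graph G" and free: "minor_free (K2_star t) G"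
  shows "\<exists>n p \<beta> q. partial_layout G (t - 1) {} n p \<beta> q"
proof -
  have "\<exists>n p \<beta> q. partial_layout G (t - 1) {} n p \<beta> q"
    if "finite R" "partial_layout G (t - 1) R n p \<beta> q" for R n p \<beta> q
    using that
  proof (induction R arbitrary: n p \<beta> q rule: finite_psubset_induct)
    case (psubset R)
    show ?case
    proof (cases "R = {}")
      case False
      then show ?thesis using partial_layout_step[OF t G free psubset.prems] psubset.IH by blast
    qed (use psubset.prems in blast)
  qed
  moreover have "finite (pverts G)" using G by (simp add: pair_graph_iff)
  ultimately show ?thesis using partial_layout_init[OF G] by blast
qed

section \<open>From the partition to the strong product\<close>

lemma pair_graph_complete_graph: "pair_graph (complete_graph n)"
proof -
  have "parcs (complete_graph n) \<subseteq> {..<n} \<times> {..<n}" by (auto simp: complete_graph_def)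
  then show ?thesis by (auto simp: pair_graph_iff complete_graph_def sym_def irrefl_def)
qed

lemma pair_graph_strong_product:
  assumes "pair_graph A" "pair_graph B"
  shows "pair_graph (strong_product A B)"
proof -
  have "sym (parcs A)" "sym (parcs B)" using assms by (auto simp: pair_graph_iff)
  then have "sym (parcs (strong_product A B))" by (auto simp: strong_product_def sym_def)
  then show ?thesis using assms
    by (auto simp: pair_graph_iff strong_product_def irrefl_def)
qed

lemma iso_to_subgraphI:
  assumes "pair_graph G" "pair_graph J" "inj_on f (pverts G)" "f ` pverts G \<subseteq> pverts J"
    "\<And>x y. (x, y) \<in> parcs G \<Longrightarrow> f x \<noteq> f y \<Longrightarrow> (f x, f y) \<in> parcs J"
  shows "iso_to_subgraph G J"
proof -
  have "pair_graph (graph_image f G)" using assms(1) by (rule pair_graph_image)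
  moreover from this have "subgraph (with_proj (graph_image f G)) (with_proj J)"
    using assms by (intro subgraph_with_projI) auto
  ultimately show ?thesis unfolding iso_to_subgraph_def
    using digraph_iso_graph_image[OF assms(1,3)] by blast
qed

text \<open>The second coordinate numbers the vertices within each part injectively by fewer than
  \<open>m\<close> numbers. Over an arc of \<open>H\<close> the numbers do not matter: equal and
  distinct ones both give an arc of the product.\<close>

lemma iso_to_subgraph_strong_product_complete:
  assumes G: "pair_graph G" and H: "pair_graph H"
    and q: "\<And>x. x \<in> pverts G \<Longrightarrow> q x \<in> pverts H"
    and fib: "\<And>j. card {x \<in> pverts G. q x = j} \<le> m"
    and edge: "\<And>x y. (x, y) \<in> parcs G \<Longrightarrow> q x = q y \<or> (q x, q y) \<in> parcs H"
  shows "iso_to_subgraph G (strong_product H (complete_graph m))"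
proof -
  have "\<exists>f. f ` {x \<in> pverts G. q x = j} \<subseteq> {..<m} \<and> inj_on f {x \<in> pverts G. q x = j}" for j
    using card_le_inj[of "{x \<in> pverts G. q x = j}" "{..<m}"] fib G by (auto simp: pair_graph_iff)
  then obtain f where f: "\<And>j. f j ` {x \<in> pverts G. q x = j} \<subseteq> {..<m}"
    "\<And>j. inj_on (f j) {x \<in> pverts G. q x = j}" by metis
  let ?h = "\<lambda>x. (q x, f (q x) x)"
  have lt: "f (q x) x < m" if "x \<in> pverts G" for x using f(1)[of "q x"] that by auto
  show ?thesis
  proof (rule iso_to_subgraphI[where f = ?h, OF G])
    show "pair_graph (strong_product H (complete_graph m))"
      by (intro pair_graph_strong_product H pair_graph_complete_graph)
    show "inj_on ?h (pverts G)"
    proof (rule inj_onI)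
      fix x y assume "x \<in> pverts G" "y \<in> pverts G" "?h x = ?h y"
      then show "x = y" using inj_onD[OF f(2)[of "q y"], of x y] by auto
    qed
    show "?h ` pverts G \<subseteq> pverts (strong_product H (complete_graph m))"
      using q lt by (auto simp: strong_product_def complete_graph_def)
  next
    fix x y assume xy: "(x, y) \<in> parcs G" "?h x \<noteq> ?h y"
    then have V: "x \<in> pverts G" "y \<in> pverts G" using G by (auto simp: pair_graph_iff)
    have "(u, v) \<in> parcs (complete_graph m)" if "u < m" "v < m" "u \<noteq> v" for u v
      using that by (simp add: complete_graph_def)
    then show "(?h x, ?h y) \<in> parcs (strong_product H (complete_graph m))"
      using xy(2) edge[OF xy(1)] q[OF V(1)] q[OF V(2)] lt[OF V(1)] lt[OF V(2)]
      by (auto simp: strong_product_def complete_graph_def)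
  qed
qed

theorem theorem24:
  fixes t :: nat and G :: "'a pair_pre_digraph"
  assumes "t \<ge> 2"
    and "pair_graph G"
    and "minor_free (K2_star t) G"
  shows "\<exists>H :: nat pair_pre_digraph. pair_graph H \<and> treewidth H \<le> 2 \<and>
    iso_to_subgraph G (strong_product H (complete_graph (t - 1)))"
proof -
  obtain n p \<beta> q where L: "partial_layout G (t - 1) {} n p \<beta> q"
    using layout_exists[OF assms] by blast
  have bt: "bag_tree 2 n p \<beta>" and q: "\<And>x. x \<in> pverts G \<Longrightarrow> q x < n"
    and fib: "\<And>j. card {x \<in> pverts G. q x = j} \<le> t - 1"
    and edge: "\<And>x y. x \<in> pverts G \<Longrightarrow> y \<in> pverts G \<Longrightarrow> (x, y) \<in> parcs G \<Longrightarrow> \<exists>i<n. q x \<in> \<beta> i \<and> q y \<in> \<beta> i"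
    using L unfolding partial_layout_def by simp_all
  let ?H = "bag_graph n \<beta>"
  have "iso_to_subgraph G (strong_product ?H (complete_graph (t - 1)))"
  proof (rule iso_to_subgraph_strong_product_complete[where q = q])
    fix x y assume xy: "(x, y) \<in> parcs G"
    then have "x \<in> pverts G" "y \<in> pverts G" using assms(2) by (auto simp: pair_graph_iff)
    then show "q x = q y \<or> (q x, q y) \<in> parcs ?H" using edge xy q by (simp add: bag_graph_def)
  qed (use assms(2) pair_graph_bag_graph q fib in \<open>simp_all add: bag_graph_def\<close>)
  moreover have "treewidth ?H \<le> 2" using treewidth_bag_graph[OF bt] by simp
  ultimately show ?thesis using pair_graph_bag_graph by blast
qed

end
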